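(* Let $\mathbb{V}$ be an $8$-dimensional real vector space with a euclidean inner product $\langle -,-\rangle$, and let $F\in\Lambda^4\mathbb{V}^*$. Then $[\iota_\Xi F, F]=0$ for all $\Xi\in\Lambda^2\mathbb{V}$ if and only if $F=F_1+F_2$ for some simple $4$-forms $F_1,F_2\in\Lambda^4\mathbb{V}^*$ which are orthogonal to each other.
   Context: Euclidean means positive-definite. For $\Xi\in\Lambda^{2}\mathbb{V}$, $\iota_\Xi F$ is the $2$-form obtained by contracting $F$ with $\Xi$; for $\Xi=X_1\wedge X_2$ it is $F(X_1,X_2,-,-)$. A $2$-form $\omega\in\Lambda^2\mathbb{V}^*\cong\mathfrak{so}(\mathbb{V})$ acts on forms $\Omega\in\Lambda\mathbb{V}^*$ by $[\omega,\Omega]$, defined for $\omega=\alpha\wedge\beta$ with $\alpha,\beta\in\mathbb{V}^*$ by $$[\alpha\wedge\beta,\Omega]=\alpha\wedge\iota_{\beta^\sharp}\Omega-\beta\wedge\iota_{\alpha^\sharp}\Omega$$ and extended linearly in $\omega$, where $\alpha^\sharp\in\mathbb{V}$ is the vector dual to $\alpha$ under the inner product. A $p$-form is simple if it can be written as a wedge product of $p$ one-forms. A nonzero simple form determines a $p$-plane, the span of those one-forms, regarded as a subspace $\Pi\subset\mathbb{V}$ using the inner product to identify $\mathbb{V}^*$ with $\mathbb{V}$. Two nonzero simple $p$-forms are orthogonal if their planes satisfy $\langle X_1,X_2\rangle=0$ for all $X_1\in\Pi_1$, $X_2\in\Pi_2$. The zero form counts as simple and as orthogonal to every simple form (so $F$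 simple is allowed as a degenerate case). *)

theory Defs
  imports "HOL-Analysis.Analysis"
begin

section \<open>Exterior forms\<close>

text \<open>
  A form on a vector space is represented by its value on lists of vectors.  A \<open>p\<close>-form is an
  alternating \<open>p\<close>-linear function, extended by \<open>0\<close> to lists of other lengths, so that equality of
  forms is equality of functions.  Vector space operations on forms are pointwise.
\<close>

definition forms :: "nat \<Rightarrow> ('b::real_vector list \<Rightarrow> real) set" where
  "forms p = {\<Omega>.
     (\<forall>xs. length xs \<noteq> p \<longrightarrow> \<Omega> xs = 0) \<and>
     (\<forall>xs i. length xs = p \<longrightarrow> i < p \<longrightarrow> linear (\<lambda>v. \<Omega> (xs[i := v]))) \<and>
     (\<forall>xs i j. length xs = p \<longrightarrow> i < j \<longrightarrow> j < p \<longrightarrow> xs ! i = xs ! j \<longrightarrow> \<Omega> xs = 0)}"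

text \<open>
  One-forms are also elements of the dual space \<open>'b \<Rightarrow>\<^sub>L real\<close> (in finite dimension every linear
  functional is bounded).  The wedge product \<open>\<alpha> \<and> \<Omega>\<close> is normalised by
  \<open>(\<alpha> \<and> \<beta>)(X, Y) = \<alpha>(X) \<beta>(Y) - \<alpha>(Y) \<beta>(X)\<close>.
\<close>

definition wedge :: "('b::real_normed_vector \<Rightarrow>\<^sub>L real) \<Rightarrow> ('b list \<Rightarrow> real) \<Rightarrow> 'b list \<Rightarrow> real" where
  "wedge \<alpha> \<Omega> xs =
     (\<Sum>i<length xs. (-1) ^ i * blinfun_apply \<alpha> (xs ! i) * \<Omega> (take i xs @ drop (Suc i) xs))"

fun wedge_list :: "('b::real_normed_vector \<Rightarrow>\<^sub>L real) list \<Rightarrow> 'b list \<Rightarrow> real" where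
  "wedge_list [] = (\<lambda>xs. if xs = [] then 1 else 0)"
| "wedge_list (\<alpha> # \<alpha>s) = wedge \<alpha> (wedge_list \<alpha>s)"

definition interior_product :: "'b \<Rightarrow> ('b list \<Rightarrow> real) \<Rightarrow> 'b list \<Rightarrow> real" where
  "interior_product v \<Omega> = (\<lambda>xs. \<Omega> (v # xs))"

text \<open>
  Bivectors, the elements of \<open>\<Lambda>\<^sup>2 V\<close>, are the \<open>2\<close>-forms on the dual space, that is, the elements of
  \<open>forms 2\<close> at type \<open>('a \<Rightarrow>\<^sub>L real) list \<Rightarrow> real\<close>.  The bivector \<open>X \<and> Y\<close> is the wedge product of
  \<open>X\<close> and \<open>Y\<close> as elements of the double dual.
\<close>

definition evaluation :: "'b::real_normed_vector \<Rightarrow> ('b \<Rightarrow>\<^sub>L real) \<Rightarrow>\<^sub>L real" where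
  "evaluation v = Blinfun (\<lambda>\<alpha>. blinfun_apply \<alpha> v)"

definition wedge_vectors :: "'b::real_normed_vector \<Rightarrow> 'b \<Rightarrow> ('b \<Rightarrow>\<^sub>L real) list \<Rightarrow> real" where
  "wedge_vectors X Y = wedge_list [evaluation X, evaluation Y]"

text \<open>The linear extension of \<open>\<iota>\<^bsub>X \<and> Y\<^esub> F = F(X, Y, -, -)\<close>, applied to
  \<open>\<Xi> = 1/2 * (\<Sum>b c. \<Xi>(b\<^sup>*, c\<^sup>*) b \<and> c)\<close>; see \<open>bivector_basis_expansion\<close> and
  \<open>contract_wedge_vectors\<close>.\<close>

definition contract ::
    "(('a::euclidean_space \<Rightarrow>\<^sub>L real) list \<Rightarrow> real) \<Rightarrow> ('a list \<Rightarrow> real) \<Rightarrow> 'a list \<Rightarrow> real" where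
  "contract \<Xi> F = (\<lambda>xs. 1/2 * (\<Sum>b\<in>Basis. \<Sum>c\<in>Basis.
     \<Xi> [blinfun_inner_left b, blinfun_inner_left c] * F (b # c # xs)))"

section \<open>The action of two-forms\<close>

definition sharp :: "('a::euclidean_space \<Rightarrow>\<^sub>L real) \<Rightarrow> 'a" where
  "sharp \<alpha> = (THE v. \<forall>x. blinfun_apply \<alpha> x = v \<bullet> x)"

definition wedge_action ::
    "('a::euclidean_space \<Rightarrow>\<^sub>L real) \<Rightarrow> ('a \<Rightarrow>\<^sub>L real) \<Rightarrow> ('a list \<Rightarrow> real) \<Rightarrow> 'a list \<Rightarrow> real" where
  "wedge_action \<alpha> \<beta> \<Omega> =
     (\<lambda>xs. wedge \<alpha> (interior_product (sharp \<beta>) \<Omega>) xs -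
       wedge \<beta> (interior_product (sharp \<alpha>) \<Omega>) xs)"

text \<open>The linear extension of \<open>[\<alpha> \<and> \<beta>, \<Omega>] = wedge_action \<alpha> \<beta> \<Omega>\<close>, applied to
  \<open>\<omega> = 1/2 * (\<Sum>b c. \<omega>(b, c) b\<^sup>* \<and> c\<^sup>*)\<close>; see \<open>two_form_basis_expansion\<close> and
  \<open>action_wedge_list\<close>.\<close>

definition action :: "('a::euclidean_space list \<Rightarrow> real) \<Rightarrow> ('a list \<Rightarrow> real) \<Rightarrow> 'a list \<Rightarrow> real" where
  "action \<omega> \<Omega> = (\<lambda>xs. 1/2 * (\<Sum>b\<in>Basis. \<Sum>c\<in>Basis.
     \<omega> [b, c] * wedge_action (blinfun_inner_left b) (blinfun_inner_left c) \<Omega> xs))"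

section \<open>Simple forms and orthogonality\<close>

definition simple_form :: "nat \<Rightarrow> ('b::real_normed_vector list \<Rightarrow> real) \<Rightarrow> bool" where
  "simple_form p \<Omega> \<longleftrightarrow> (\<exists>\<alpha>s. length \<alpha>s = p \<and> \<Omega> = wedge_list \<alpha>s)"

text \<open>Well defined for nonzero simple forms by \<open>plane_wedge_list\<close> below.\<close>

definition plane :: "('a::euclidean_space list \<Rightarrow> real) \<Rightarrow> 'a set" where
  "plane \<Omega> = (THE P. \<exists>\<alpha>s. \<Omega> = wedge_list \<alpha>s \<and> P = span (sharp ` set \<alpha>s))"

definition orthogonal_forms :: "('a::euclidean_space list \<Rightarrow> real) \<Rightarrow> ('a list \<Rightarrow> real) \<Rightarrow> bool" where
  "orthogonal_forms \<Omega>1 \<Omega>2 \<longleftrightarrow>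
     \<Omega>1 = (\<lambda>_. 0) \<or> \<Omega>2 = (\<lambda>_. 0) \<or>
     (\<forall>X1\<in>plane \<Omega>1. \<forall>X2\<in>plane \<Omega>2. X1 \<bullet> X2 = 0)"

section \<open>Adequacy of the definitions\<close>

lemma sharp_inner: "sharp \<alpha> \<bullet> x = blinfun_apply \<alpha> x"
proof -
  define v where "v = (\<Sum>b\<in>Basis. blinfun_apply \<alpha> b *\<^sub>R b)"
  have v: "blinfun_apply \<alpha> x = v \<bullet> x" for x
  proof -
    have "blinfun_apply \<alpha> x = blinfun_apply \<alpha> (\<Sum>b\<in>Basis. (x \<bullet> b) *\<^sub>R b)"
      by (simp add: euclidean_representation)
    also have "\<dots> = (\<Sum>b\<in>Basis. (x \<bullet> b) * blinfun_apply \<alpha> b)"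
      by (simp add: blinfun.sum_right blinfun.scaleR_right)
    also have "\<dots> = v \<bullet> x"
      by (simp add: v_def inner_sum_left inner_commute[of x] mult.commute)
    finally show ?thesis .
  qed
  have "sharp \<alpha> = v"
    unfolding sharp_def
  proof (rule the_equality)
    show "\<forall>x. blinfun_apply \<alpha> x = v \<bullet> x" using v by blast
  next
    fix w assume "\<forall>x. blinfun_apply \<alpha> x = w \<bullet> x"
    then show "w = v" using v by (metis vector_eq_rdot)
  qed
  then show ?thesis using v by simp
qed

lemma linear_sharp: "linear sharp"
  by (intro linearI; rule vector_eq_rdot[THEN iffD1])
    (simp_all add: sharp_inner inner_add_left blinfun.add_left blinfun.scaleR_left)

lemma sharp_blinfun_inner_left [simp]: "sharp (blinfun_inner_left b) = b"
  by (metis vector_eq_rdot sharp_inner blinfun_inner_left.rep_eq inner_commute)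

lemma evaluation_apply [simp]: "blinfun_apply (evaluation v) \<alpha> = blinfun_apply \<alpha> v"
  unfolding evaluation_def by (simp add: bounded_linear_Blinfun_apply)

lemma wedge_Nil [simp]: "wedge \<alpha> \<Omega> [] = 0"
  by (simp add: wedge_def)

lemma wedge_Cons:
  "wedge \<alpha> \<Omega> (v # xs) = blinfun_apply \<alpha> v * \<Omega> xs - wedge \<alpha> (interior_product v \<Omega>) xs"
  by (simp add: wedge_def interior_product_def sum.lessThan_Suc_shift sum_negf del: sum.lessThan_Suc)

lemma wedge_zero [simp]: "wedge \<alpha> (\<lambda>_. 0) = (\<lambda>_. 0)"
  by (simp add: wedge_def fun_eq_iff)

lemma wedge_scale: "wedge \<alpha> (\<lambda>xs. c * \<Omega> xs) xs = c * wedge \<alpha> \<Omega> xs"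
  by (simp add: wedge_def sum_distrib_left algebra_simps)

lemma wedge_diff: "wedge \<alpha> (\<lambda>xs. \<Omega> xs - \<Psi> xs) xs = wedge \<alpha> \<Omega> xs - wedge \<alpha> \<Psi> xs"
  by (simp add: wedge_def sum_subtractf algebra_simps)

lemma interior_product_wedge:
  "interior_product v (wedge \<alpha> \<Omega>) = (\<lambda>xs. blinfun_apply \<alpha> v * \<Omega> xs - wedge \<alpha> (interior_product v \<Omega>) xs)"
  by (simp add: interior_product_def wedge_Cons fun_eq_iff)

lemma wedge_anticommute: "wedge \<alpha> (wedge \<beta> \<Omega>) xs = - wedge \<beta> (wedge \<alpha> \<Omega>) xs"
proof (induction xs arbitrary: \<Omega>)
  case Nil
  then show ?case by simp
next
  case (Cons v xs)
  show ?case
    using Cons.IH[of "interior_product v \<Omega>"]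
    by (simp add: wedge_Cons interior_product_wedge wedge_diff wedge_scale)
qed

lemma wedge_self: "wedge \<alpha> (wedge \<alpha> \<Omega>) = (\<lambda>_. 0)"
  using wedge_anticommute[of \<alpha> \<alpha> \<Omega>] by (auto simp: fun_eq_iff)

lemma wedge_list_two:
  "wedge_list [\<alpha>, \<beta>] [X, Y] =
     blinfun_apply \<alpha> X * blinfun_apply \<beta> Y - blinfun_apply \<alpha> Y * blinfun_apply \<beta> X"
  by (simp add: wedge_Cons interior_product_def)

lemma wedge_list_length: "length xs \<noteq> length \<alpha>s \<Longrightarrow> wedge_list \<alpha>s xs = 0"
  by (induction \<alpha>s arbitrary: xs) (auto simp: wedge_def intro!: sum.neutral)

lemma wedge_list_linear: "linear (\<lambda>v. wedge_list \<alpha>s (us @ v # zs))"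
proof (induction \<alpha>s arbitrary: us zs)
  case Nil
  then show ?case by (simp add: linear_zero)
next
  case (Cons \<alpha> \<alpha>s)
  have "linear (\<lambda>v. wedge \<alpha> \<Omega> (us @ v # zs))"
    if "\<And>us zs. linear (\<lambda>v. \<Omega> (us @ v # zs))" for \<Omega> :: "'a list \<Rightarrow> real"
    using that
  proof (induction us arbitrary: \<Omega>)
    case Nil
    have "linear (\<lambda>v. (-1) ^ k * blinfun_apply \<alpha> (zs ! k) * \<Omega> (v # take k zs @ drop (Suc k) zs))" for k
      using linear_compose_scale_right[OF Nil[of "[]" "take k zs @ drop (Suc k) zs"],
          of "(-1) ^ k * blinfun_apply \<alpha> (zs ! k)"] by simp
    then have "linear (\<lambda>v. wedge \<alpha> (interior_product v \<Omega>) zs)"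
      unfolding wedge_def interior_product_def by (intro linear_compose_sum) blast
    moreover have "linear (\<lambda>v. blinfun_apply \<alpha> v * \<Omega> zs)"
      by (simp add: linear_iff blinfun.add_right blinfun.scaleR_right algebra_simps)
    ultimately show ?case by (simp add: wedge_Cons linear_compose_sub)
  next
    case (Cons u us)
    have "linear (\<lambda>v. wedge \<alpha> (interior_product u \<Omega>) (us @ v # zs))"
      using Cons.prems[of "u # _"] by (intro Cons.IH) (simp add: interior_product_def)
    moreover have "linear (\<lambda>v. blinfun_apply \<alpha> u * \<Omega> (us @ v # zs))"
      using linear_compose_scale_right[OF Cons.prems[of us zs], of "blinfun_apply \<alpha> u"] by simp
    ultimately show ?case by (simp add: wedge_Cons linear_compose_sub)
  qed
  from this[OF Cons.IH] show ?case by simp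
qed

lemma wedge_list_swap: "wedge_list \<alpha>s (us @ x # y # zs) = - wedge_list \<alpha>s (us @ y # x # zs)"
proof (induction \<alpha>s arbitrary: us x y zs)
  case Nil
  then show ?case by simp
next
  case (Cons \<alpha> \<alpha>s)
  have "wedge \<alpha> \<Omega> (us @ x # y # zs) = - wedge \<alpha> \<Omega> (us @ y # x # zs)"
    if "\<And>us x y zs. \<Omega> (us @ x # y # zs) = - \<Omega> (us @ y # x # zs)" for \<Omega> :: "'a list \<Rightarrow> real"
    using that
  proof (induction us arbitrary: \<Omega>)
    case Nil
    have "interior_product y (interior_product x \<Omega>) ws = (-1) * interior_product x (interior_product y \<Omega>) ws" for ws
      using Nil[of "[]" x y ws] by (simp add: interior_product_def)
    then have "wedge \<alpha> (interior_product y (interior_product x \<Omega>)) zs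
        = wedge \<alpha> (\<lambda>ws. (-1) * interior_product x (interior_product y \<Omega>) ws) zs"
      by presburger
    then have "wedge \<alpha> (interior_product y (interior_product x \<Omega>)) zs = - wedge \<alpha> (interior_product x (interior_product y \<Omega>)) zs"
      unfolding wedge_scale by simp
    then show ?case by (simp add: wedge_Cons interior_product_def)
  next
    case (Cons u us)
    have "wedge \<alpha> (interior_product u \<Omega>) (us @ x # y # zs) = - wedge \<alpha> (interior_product u \<Omega>) (us @ y # x # zs)"
    proof (rule Cons.IH)
      fix us x y zs
      show "interior_product u \<Omega> (us @ x # y # zs) = - interior_product u \<Omega> (us @ y # x # zs)"
        using Cons.prems[of "u # us" x y zs] by (simp add: interior_product_def)
    qed
    then show ?case using Cons.prems[of us x y zs] by (simp add: wedge_Cons)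
  qed
  then show ?case unfolding wedge_list.simps using Cons.IH by blast
qed

lemma wedge_list_repeat: "wedge_list \<alpha>s (us @ x # ws @ x # zs) = 0"
proof (induction ws arbitrary: us)
  case Nil
  then show ?case using wedge_list_swap[of \<alpha>s us x x zs] by simp
next
  case (Cons w ws)
  then show ?case
    using wedge_list_swap[of \<alpha>s us x w "ws @ x # zs"] Cons.IH[of "us @ [w]"] by simp
qed

lemma wedge_list_forms: "wedge_list \<alpha>s \<in> forms (length \<alpha>s)"
proof -
  have "wedge_list \<alpha>s xs = 0" if ij: "i < j" "j < length xs" "xs ! i = xs ! j" for xs i j
  proof -
    have 1: "take i xs @ xs ! i # drop (Suc i) xs = xs"
      using ij by (intro id_take_nth_drop[symmetric]) simp
    have "take (j - Suc i) (drop (Suc i) xs) @ drop (Suc i) xs ! (j - Suc i) #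
        drop (Suc (j - Suc i)) (drop (Suc i) xs) = drop (Suc i) xs"
      using ij by (intro id_take_nth_drop[symmetric]) simp
    then have 2: "take (j - Suc i) (drop (Suc i) xs) @ xs ! i # drop (Suc j) xs = drop (Suc i) xs"
      using ij by simp
    show ?thesis
      using wedge_list_repeat[of \<alpha>s "take i xs" "xs ! i" "take (j - Suc i) (drop (Suc i) xs)"
          "drop (Suc j) xs"]
      unfolding 2 1 .
  qed
  then show ?thesis
    by (auto simp: forms_def wedge_list_length upd_conv_take_nth_drop wedge_list_linear)
qed

lemma simple_form_forms: "simple_form p \<Omega> \<Longrightarrow> \<Omega> \<in> forms p"
  using wedge_list_forms by (auto simp: simple_form_def)

lemma simple_form_zero: "p > 0 \<Longrightarrow> simple_form p (\<lambda>_. 0)"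
  by (intro simple_form_def[THEN iffD2] exI[of _ "0 # replicate (p - 1) 0"])
    (simp add: wedge_def fun_eq_iff)

lemma form_eq_0: "\<Omega> \<in> forms p \<Longrightarrow> length xs \<noteq> p \<Longrightarrow> \<Omega> xs = 0"
  unfolding forms_def by blast

lemma form_linear:
  assumes "\<Omega> \<in> forms p"
  shows "linear (\<lambda>v. \<Omega> (us @ v # zs))"
proof (cases "length (us @ undefined # zs) = p")
  case True
  have "linear (\<lambda>v. \<Omega> ((us @ undefined # zs)[length us := v]))"
    using assms True unfolding forms_def mem_Collect_eq
    by (metis length_append length_Cons less_add_Suc1 add_Suc_right)
  then show ?thesis by simp
next
  case False
  then have "(\<lambda>v. \<Omega> (us @ v # zs)) = (\<lambda>v. 0)"
    using form_eq_0[OF assms] by simp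
  then show ?thesis by (simp add: linear_zero)
qed

lemma form_linear_head:
  assumes "\<Omega> \<in> forms p"
  shows "linear (\<lambda>v. \<Omega> (v # xs))" "linear (\<lambda>v. \<Omega> (b # v # xs))"
  using form_linear[OF assms, of "[]" xs] form_linear[OF assms, of "[b]" xs] by simp_all

lemma form_swap:
  assumes "\<Omega> \<in> forms p"
  shows "\<Omega> (y # x # zs) = - \<Omega> (x # y # zs)"
proof -
  have alt: "\<Omega> (a # a # zs) = 0" for a
  proof (cases "length (a # a # zs) = p")
    case True
    have "length xs = p \<Longrightarrow> i < j \<Longrightarrow> j < p \<Longrightarrow> xs ! i = xs ! j \<Longrightarrow> \<Omega> xs = 0" for xs i j
      using assms unfolding forms_def by blast
    from this[of "a # a # zs" 0 1] True show ?thesis by simp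
  qed (rule form_eq_0[OF assms])
  note l = form_linear_head[OF assms]
  have "\<Omega> ((x + y) # (x + y) # zs)
      = \<Omega> (x # x # zs) + \<Omega> (x # y # zs) + (\<Omega> (y # x # zs) + \<Omega> (y # y # zs))"
    by (simp only: linear_add[OF l(1)] linear_add[OF l(2)])
  then show ?thesis by (simp add: alt)
qed

lemma blinfun_basis_sum:
  fixes \<alpha> :: "'a::euclidean_space \<Rightarrow>\<^sub>L real"
  shows "(\<Sum>b\<in>Basis. (x \<bullet> b) * blinfun_apply \<alpha> b) = blinfun_apply \<alpha> x"
  using blinfun.sum_right[of \<alpha> "\<lambda>b. (x \<bullet> b) *\<^sub>R b" Basis]
  by (simp add: blinfun.scaleR_right euclidean_representation)

lemma blinfun_representation:
  fixes \<alpha> :: "'a::euclidean_space \<Rightarrow>\<^sub>L real"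
  shows "\<alpha> = (\<Sum>b\<in>Basis. blinfun_apply \<alpha> b *\<^sub>R blinfun_inner_left b)"
proof (rule blinfun_eqI)
  fix x
  show "blinfun_apply \<alpha> x = blinfun_apply (\<Sum>b\<in>Basis. blinfun_apply \<alpha> b *\<^sub>R blinfun_inner_left b) x"
    using blinfun_basis_sum[of x \<alpha>] by (simp add: blinfun.sum_left blinfun.scaleR_left mult.commute)
qed

lemma bilinear_basis_sum:
  fixes f :: "'a::euclidean_space \<Rightarrow> 'a \<Rightarrow> real"
  assumes 1: "\<And>w. linear (\<lambda>v. f v w)" and 2: "\<And>v. linear (f v)"
  shows "(\<Sum>b\<in>Basis. \<Sum>c\<in>Basis. f b c * ((x \<bullet> b) * (y \<bullet> c))) = f x y"
proof -
  have e: "g z = (\<Sum>b\<in>Basis. (z \<bullet> b) * g b)" if g: "linear g" for g :: "'a \<Rightarrow> real" and z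
  proof -
    have "g (\<Sum>b\<in>Basis. (z \<bullet> b) *\<^sub>R b) = (\<Sum>b\<in>Basis. (z \<bullet> b) * g b)"
      by (simp only: linear_sum[OF g] linear_scale[OF g] real_scaleR_def)
    then show ?thesis by (simp only: euclidean_representation)
  qed
  have "f x y = (\<Sum>b\<in>Basis. (x \<bullet> b) * f b y)"
    by (rule e[of "\<lambda>v. f v y", OF 1])
  also have "\<dots> = (\<Sum>b\<in>Basis. (x \<bullet> b) * (\<Sum>c\<in>Basis. (y \<bullet> c) * f b c))"
    by (simp only: e[OF 2, of _ y])
  finally show ?thesis by (simp only: sum_distrib_left mult_ac)
qed

lemma bilinear_dual_basis_sum:
  fixes f :: "('a::euclidean_space \<Rightarrow>\<^sub>L real) \<Rightarrow> ('a \<Rightarrow>\<^sub>L real) \<Rightarrow> real"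
  assumes 1: "\<And>w. linear (\<lambda>v. f v w)" and 2: "\<And>v. linear (f v)"
  shows "(\<Sum>b\<in>Basis. \<Sum>c\<in>Basis. f (blinfun_inner_left b) (blinfun_inner_left c) *
           (blinfun_apply \<alpha> b * blinfun_apply \<beta> c)) = f \<alpha> \<beta>"
proof -
  have e: "g \<gamma> = (\<Sum>b\<in>Basis. blinfun_apply \<gamma> b * g (blinfun_inner_left b))"
    if g: "linear g" for g :: "('a \<Rightarrow>\<^sub>L real) \<Rightarrow> real" and \<gamma>
  proof -
    have "g (\<Sum>b\<in>Basis. blinfun_apply \<gamma> b *\<^sub>R blinfun_inner_left b)
        = (\<Sum>b\<in>Basis. blinfun_apply \<gamma> b * g (blinfun_inner_left b))"
      by (simp only: linear_sum[OF g] linear_scale[OF g] real_scaleR_def)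
    then show ?thesis by (simp only: blinfun_representation[symmetric])
  qed
  have "f \<alpha> \<beta> = (\<Sum>b\<in>Basis. blinfun_apply \<alpha> b * f (blinfun_inner_left b) \<beta>)"
    by (rule e[of "\<lambda>v. f v \<beta>", OF 1])
  also have "\<dots> = (\<Sum>b\<in>Basis. blinfun_apply \<alpha> b *
      (\<Sum>c\<in>Basis. blinfun_apply \<beta> c * f (blinfun_inner_left b) (blinfun_inner_left c)))"
    by (simp only: e[OF 2, of _ \<beta>])
  finally show ?thesis by (simp only: sum_distrib_left mult_ac)
qed

lemma antisymmetric_sum:
  fixes f g w :: "'b \<Rightarrow> 'b \<Rightarrow> real"
  assumes w: "\<And>b c. w c b = - w b c" and g: "\<And>b c. g b c = f b c - f c b"
  shows "1/2 * (\<Sum>b\<in>B. \<Sum>c\<in>B. w b c * g b c) = (\<Sum>b\<in>B. \<Sum>c\<in>B. w b c * f b c)"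
proof -
  have "(\<Sum>b\<in>B. \<Sum>c\<in>B. w b c * f c b) = (\<Sum>b\<in>B. \<Sum>c\<in>B. w c b * f b c)"
    by (rule sum.swap)
  also have "\<dots> = (\<Sum>b\<in>B. \<Sum>c\<in>B. - (w b c * f b c))"
    by (intro sum.cong refl) (metis w mult_minus_left)
  also have "\<dots> = - (\<Sum>b\<in>B. \<Sum>c\<in>B. w b c * f b c)"
    by (simp add: sum_negf)
  finally show ?thesis by (simp add: g right_diff_distrib sum_subtractf)
qed

lemma two_form_basis_expansion:
  fixes \<omega> :: "'a::euclidean_space list \<Rightarrow> real"
  assumes "\<omega> \<in> forms 2"
  shows "\<omega> xs = 1/2 * (\<Sum>b\<in>Basis. \<Sum>c\<in>Basis.
           \<omega> [b, c] * wedge_list [blinfun_inner_left b, blinfun_inner_left c] xs)"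
proof (cases "length xs = 2")
  case False
  then have "\<omega> xs = 0" by (rule form_eq_0[OF assms])
  with False show ?thesis by (simp add: wedge_list_length del: wedge_list.simps)
next
  case True
  then obtain x y where xs: "xs = [x, y]"
    by (auto simp: numeral_2_eq_2 length_Suc_conv)
  note l = form_linear_head[OF assms]
  have "1/2 * (\<Sum>b\<in>Basis. \<Sum>c\<in>Basis.
           \<omega> [b, c] * wedge_list [blinfun_inner_left b, blinfun_inner_left c] xs)
     = (\<Sum>b\<in>Basis. \<Sum>c\<in>Basis. \<omega> [b, c] * ((x \<bullet> b) * (y \<bullet> c)))"
    unfolding xs wedge_list_two blinfun_inner_left.rep_eq
    by (rule antisymmetric_sum) (rule form_swap[OF assms], simp)
  also have "\<dots> = \<omega> xs"
    unfolding xs by (rule bilinear_basis_sum) (rule l)+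
  finally show ?thesis by (rule sym)
qed

lemma bivector_basis_expansion:
  fixes \<Xi> :: "('a::euclidean_space \<Rightarrow>\<^sub>L real) list \<Rightarrow> real"
  assumes "\<Xi> \<in> forms 2"
  shows "\<Xi> \<alpha>s = 1/2 * (\<Sum>b\<in>Basis. \<Sum>c\<in>Basis.
           \<Xi> [blinfun_inner_left b, blinfun_inner_left c] * wedge_vectors b c \<alpha>s)"
proof (cases "length \<alpha>s = 2")
  case False
  then have "\<Xi> \<alpha>s = 0" by (rule form_eq_0[OF assms])
  with False show ?thesis
    by (simp add: wedge_vectors_def wedge_list_length del: wedge_list.simps)
next
  case True
  then obtain \<alpha> \<beta> where \<alpha>s: "\<alpha>s = [\<alpha>, \<beta>]"
    by (auto simp: numeral_2_eq_2 length_Suc_conv)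
  note l = form_linear_head[OF assms]
  define e :: "'a \<Rightarrow> 'a \<Rightarrow>\<^sub>L real" where "e = blinfun_inner_left"
  have "1/2 * (\<Sum>b\<in>Basis. \<Sum>c\<in>Basis. \<Xi> [e b, e c] * wedge_vectors b c \<alpha>s)
     = (\<Sum>b\<in>Basis. \<Sum>c\<in>Basis. \<Xi> [e b, e c] * (blinfun_apply \<alpha> b * blinfun_apply \<beta> c))"
    unfolding \<alpha>s wedge_vectors_def wedge_list_two evaluation_apply
    by (rule antisymmetric_sum) (rule form_swap[OF assms], simp)
  also have "\<dots> = \<Xi> \<alpha>s"
    unfolding \<alpha>s e_def by (rule bilinear_dual_basis_sum) (rule l)+
  finally show ?thesis unfolding e_def by (rule sym)
qed

lemma contract_wedge_vectors:
  assumes "F \<in> forms p"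
  shows "contract (wedge_vectors X Y) F = (\<lambda>xs. F (X # Y # xs))"
proof
  fix xs
  note l = form_linear_head[OF assms]
  have "contract (wedge_vectors X Y) F xs
      = 1/2 * (\<Sum>b\<in>Basis. \<Sum>c\<in>Basis. F (b # c # xs) * ((X \<bullet> b) * (Y \<bullet> c) - (X \<bullet> c) * (Y \<bullet> b)))"
    unfolding contract_def wedge_vectors_def wedge_list_two evaluation_apply
    by (simp add: mult.commute)
  also have "\<dots> = (\<Sum>b\<in>Basis. \<Sum>c\<in>Basis. F (b # c # xs) * ((X \<bullet> b) * (Y \<bullet> c)))"
    by (rule antisymmetric_sum) (rule form_swap[OF assms], simp)
  also have "\<dots> = F (X # Y # xs)"
    by (rule bilinear_basis_sum) (rule l)+
  finally show "contract (wedge_vectors X Y) F xs = F (X # Y # xs)" .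
qed

lemma action_wedge_list:
  assumes "\<Omega> \<in> forms p"
  shows "action (wedge_list [\<alpha>, \<beta>]) \<Omega> = wedge_action \<alpha> \<beta> \<Omega>"
proof
  fix xs
  define G where "G = (\<lambda>\<gamma> v. wedge \<gamma> (interior_product v \<Omega>) xs)"
  have G1: "linear (\<lambda>\<gamma>. G \<gamma> v)" for v
    unfolding G_def wedge_def linear_iff
    by (simp add: blinfun.add_left blinfun.scaleR_left algebra_simps sum.distrib sum_distrib_left)
  have G2: "linear (\<lambda>v. G \<gamma> v)" for \<gamma>
  proof -
    note l = form_linear_head(1)[OF assms]
    show ?thesis
      unfolding G_def wedge_def interior_product_def linear_iff
      by (simp add: linear_add[OF l] linear_scale[OF l] algebra_simps sum.distrib sum_distrib_left)
  qed
  define e :: "'a \<Rightarrow> 'a \<Rightarrow>\<^sub>L real" where "e = blinfun_inner_left"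
  have G2': "linear (\<lambda>\<delta>. G \<gamma> (sharp \<delta>))" for \<gamma>
    using linear_compose[OF linear_sharp G2[of \<gamma>]] by (simp add: o_def)
  have GG: "(\<Sum>b\<in>Basis. \<Sum>c\<in>Basis. G (e b) c * (blinfun_apply \<gamma> b * blinfun_apply \<delta> c))
      = G \<gamma> (sharp \<delta>)" for \<gamma> \<delta> :: "'a \<Rightarrow>\<^sub>L real"
    using bilinear_dual_basis_sum[of "\<lambda>\<gamma> \<delta>. G \<gamma> (sharp \<delta>)" \<gamma> \<delta>, OF G1 G2'] by (simp add: e_def)
  have "action (wedge_list [\<alpha>, \<beta>]) \<Omega> xs
      = 1/2 * (\<Sum>b\<in>Basis. \<Sum>c\<in>Basis. wedge_list [\<alpha>, \<beta>] [b, c] * (G (e b) c - G (e c) b))"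
    by (simp add: action_def wedge_action_def G_def e_def del: wedge_list.simps)
  also have "\<dots> = (\<Sum>b\<in>Basis. \<Sum>c\<in>Basis. wedge_list [\<alpha>, \<beta>] [b, c] * G (e b) c)"
    by (rule antisymmetric_sum) (simp_all add: wedge_list_two del: wedge_list.simps)
  also have "\<dots> = (\<Sum>b\<in>Basis. \<Sum>c\<in>Basis. G (e b) c * (blinfun_apply \<alpha> b * blinfun_apply \<beta> c))
      - (\<Sum>b\<in>Basis. \<Sum>c\<in>Basis. G (e b) c * (blinfun_apply \<beta> b * blinfun_apply \<alpha> c))"
    unfolding wedge_list_two by (simp add: sum_subtractf algebra_simps)
  also have "\<dots> = wedge_action \<alpha> \<beta> \<Omega> xs"
    unfolding GG by (simp add: wedge_action_def G_def)
  finally show "action (wedge_list [\<alpha>, \<beta>]) \<Omega> xs = wedge_action \<alpha> \<beta> \<Omega> xs" .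
qed

lemma wedge_wedge_list_member: "\<alpha> \<in> set \<alpha>s \<Longrightarrow> wedge \<alpha> (wedge_list \<alpha>s) = (\<lambda>_. 0)"
proof (induction \<alpha>s)
  case Nil
  then show ?case by simp
next
  case (Cons \<beta> \<alpha>s)
  show ?case
  proof (cases "\<alpha> = \<beta>")
    case True
    then show ?thesis by (simp add: wedge_self)
  next
    case False
    then have "wedge \<alpha> (wedge_list \<alpha>s) = (\<lambda>_. 0)" using Cons by simp
    then have "wedge \<beta> (wedge \<alpha> (wedge_list \<alpha>s)) xs = 0" for xs by simp
    then show ?thesis using wedge_anticommute[of \<alpha> \<beta> "wedge_list \<alpha>s"] by (simp add: fun_eq_iff)
  qed
qed

lemma interior_product_wedge_list_eq_0:
  assumes "\<And>\<alpha>. \<alpha> \<in> set \<alpha>s \<Longrightarrow> blinfun_apply \<alpha> v = 0"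
  shows "interior_product v (wedge_list \<alpha>s) = (\<lambda>_. 0)"
  using assms by (induction \<alpha>s) (simp_all add: interior_product_wedge, simp add: interior_product_def)

lemma interior_product_wedge_list_eq_0_iff:
  assumes "wedge_list \<alpha>s \<noteq> (\<lambda>_. 0)"
  shows "interior_product v (wedge_list \<alpha>s) = (\<lambda>_. 0) \<longleftrightarrow> (\<forall>\<alpha>\<in>set \<alpha>s. blinfun_apply \<alpha> v = 0)"
proof
  assume 0: "interior_product v (wedge_list \<alpha>s) = (\<lambda>_. 0)"
  show "\<forall>\<alpha>\<in>set \<alpha>s. blinfun_apply \<alpha> v = 0"
  proof
    fix \<alpha> assume "\<alpha> \<in> set \<alpha>s"
    then have "interior_product v (wedge \<alpha> (wedge_list \<alpha>s)) = (\<lambda>_. 0)"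
      by (simp add: wedge_wedge_list_member interior_product_def)
    then have "blinfun_apply \<alpha> v * wedge_list \<alpha>s xs = 0" for xs
      by (simp only: interior_product_wedge 0 wedge_zero) (metis diff_zero)
    then show "blinfun_apply \<alpha> v = 0" using assms by (auto simp: fun_eq_iff)
  qed
qed (simp add: interior_product_wedge_list_eq_0)

lemma plane_wedge_list:
  fixes \<alpha>s :: "('a::euclidean_space \<Rightarrow>\<^sub>L real) list"
  assumes "wedge_list \<alpha>s \<noteq> (\<lambda>_. 0)"
  shows "plane (wedge_list \<alpha>s) = span (sharp ` set \<alpha>s)"
proof -
  have *: "span (sharp ` set \<beta>s) =
      orthogonal_comp {v. interior_product v (wedge_list \<alpha>s) = (\<lambda>_. 0)}"
    if "wedge_list \<alpha>s = wedge_list \<beta>s" for \<beta>s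
  proof -
    have "{v. interior_product v (wedge_list \<alpha>s) = (\<lambda>_. 0)} = orthogonal_comp (span (sharp ` set \<beta>s))"
    proof -
      have "(\<forall>y\<in>span S. orthogonal y x) \<longleftrightarrow> (\<forall>y\<in>S. orthogonal y x)" for S :: "'a set" and x
        by (meson orthogonal_commute orthogonal_to_span span_base)
      then show ?thesis
        using assms unfolding that
        by (auto simp: interior_product_wedge_list_eq_0_iff orthogonal_comp_def orthogonal_def sharp_inner)
    qed
    then show ?thesis by (simp add: orthogonal_comp_self)
  qed
  show ?thesis
    unfolding plane_def by (rule the_equality) (use * in \<open>blast, metis *\<close>)
qed

end

theory Submission
  imports Defs
begin

text \<open>
  Let \<open>[x, y, z]\<close> be the vector with \<open>\<langle>[x, y, z], w\<rangle> = F(x, y, z, w)\<close>.  The condition on \<open>F\<close> says that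
  every \<open>[X, Y, -]\<close> is a derivation of this bracket, that is, \<open>V\<close> is a metric 3-Lie algebra.

  Let \<open>F\<close> attain its maximum \<open>c > 0\<close> over unit vectors at \<open>(e1, e2, e3, e4)\<close>.  Criticality makes the
  \<open>ei\<close> orthonormal with \<open>[e1, e2, e3] = c e4\<close> etc., so the skew maps \<open>[ei, ej, -]\<close> satisfy the
  commutation relations of \<open>so(4)\<close>.  For \<open>u\<close> orthogonal to all \<open>ei\<close>, the second variation of \<open>F\<close> in the
  directions \<open>w1 = -[e2, e3, u] / c\<close>, \<open>w2 = -[e3, e1, u] / c\<close>, \<open>w3 = -[e1, e2, u] / c\<close>, \<open>w4 = s u\<close> gives, with
  \<open>S\<close> the sum of the \<open>|[ei, ej, u]|\<^sup>2\<close> over \<open>i < j < 4\<close> and \<open>B\<close> the sum of the \<open>|[ei, e4, u]|\<^sup>2\<close>,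
  \<open>S - B + 2 s S \<le> c\<^sup>2 s\<^sup>2 |u|\<^sup>2\<close> for all \<open>s\<close>.  At \<open>s = 0\<close> this is \<open>S \<le> B\<close>; adding this up over the
  choices of the index playing the role of \<open>4\<close> gives equality, and then \<open>s \<rightarrow> 0\<close> gives \<open>S = 0\<close>.  Hence
  \<open>[ei, ej, -]\<close> vanishes on the orthogonal complement of the \<open>ei\<close>, the derivation property kills the
  remaining mixed components of \<open>F\<close>, and \<open>F\<close> is \<open>c e1 \<and> e2 \<and> e3 \<and> e4\<close> plus a \<open>4\<close>-form on a
  \<open>4\<close>-dimensional space.

  Conversely, a skew map of a \<open>4\<close>-plane is traceless, so it annihilates the volume form of that plane.
\<close>

section \<open>Alternating four-linear functions\<close>

text \<open>Subtracting the projections onto the members of \<open>B\<close> leaves a vector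
  orthogonal to \<open>B\<close>, where \<open>f\<close> vanishes. Thus \<open>B\<close> may span a
  proper subspace.\<close>

lemma orthonormal_linear_expansion:
  fixes f :: "'a::euclidean_space \<Rightarrow> real"
  assumes f: "linear f" and B: "finite B" "pairwise orthogonal B" "\<And>b. b \<in> B \<Longrightarrow> norm b = 1"
    and 0: "\<And>x. (\<And>b. b \<in> B \<Longrightarrow> x \<bullet> b = 0) \<Longrightarrow> f x = 0"
  shows "f x = (\<Sum>b\<in>B. (x \<bullet> b) * f b)"
proof -
  have "(x - (\<Sum>b\<in>B. (x \<bullet> b) *\<^sub>R b)) \<bullet> a = 0" if a: "a \<in> B" for a
  proof -
    have "(\<Sum>b\<in>B. (x \<bullet> b) *\<^sub>R b) \<bullet> a = (\<Sum>b\<in>B. if b = a then x \<bullet> a else 0)"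
      unfolding inner_sum_left
      using B(2,3) a by (intro sum.cong) (auto simp: pairwise_def orthogonal_def dot_square_norm)
    then show ?thesis using a B(1) by (simp add: inner_diff_left)
  qed
  then have "f (x - (\<Sum>b\<in>B. (x \<bullet> b) *\<^sub>R b)) = 0" by (rule 0)
  then show ?thesis
    by (simp add: linear_diff[OF f] linear_sum[OF f] linear_scale[OF f])
qed

lemma linear_eq_0_on_orthogonal_sum:
  fixes f :: "'a::euclidean_space \<Rightarrow> real"
  assumes "linear f" "finite B" "pairwise orthogonal B" "\<And>b. b \<in> B \<Longrightarrow> norm b = 1"
    and "\<And>b. b \<in> B \<Longrightarrow> f b = 0" and "\<And>x. (\<And>b. b \<in> B \<Longrightarrow> x \<bullet> b = 0) \<Longrightarrow> f x = 0"
  shows "f x = 0"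
proof -
  have "f x = (\<Sum>b\<in>B. (x \<bullet> b) * f b)"
    by (rule orthonormal_linear_expansion[OF assms(1-4)]) (assumption | rule assms(6))+
  then show ?thesis by (simp add: assms(5))
qed

lemma linear_Basis_expansion:
  fixes f :: "'a::euclidean_space \<Rightarrow> real"
  assumes "linear f"
  shows "f x = (\<Sum>b\<in>Basis. (x \<bullet> b) * f b)"
proof -
  have "f x = f (\<Sum>b\<in>Basis. (x \<bullet> b) *\<^sub>R b)" by (simp only: euclidean_representation)
  then show ?thesis by (simp only: linear_sum[OF assms] linear_scale[OF assms] real_scaleR_def)
qed

text \<open>Adjacent transpositions generate all permutations, so the three sign rules encode full
  alternation and carry linearity from the first slot to the others.\<close>

locale alternating4 =
  fixes G :: "'a::euclidean_space \<Rightarrow> 'a \<Rightarrow> 'a \<Rightarrow> 'a \<Rightarrow> real"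
  assumes linear1: "linear (\<lambda>x. G x y z w)"
    and swap12: "G y x z w = - G x y z w"
    and swap23: "G x z y w = - G x y z w"
    and swap34: "G x y w z = - G x y z w"
begin

lemma linear2: "linear (\<lambda>y. G x y z w)"
  using linear_compose_neg[OF linear1] by (subst swap12) simp

lemma linear3: "linear (\<lambda>z. G x y z w)"
  using linear_compose_neg[OF linear2] by (subst swap23) simp

lemma linear4: "linear (\<lambda>w. G x y z w)"
  using linear_compose_neg[OF linear3] by (subst swap34) simp

lemmas multilinear =
  linear_add[OF linear1] linear_add[OF linear2] linear_add[OF linear3] linear_add[OF linear4]
  linear_scale[OF linear1, unfolded real_scaleR_def] linear_scale[OF linear2, unfolded real_scaleR_def]
  linear_scale[OF linear3, unfolded real_scaleR_def] linear_scale[OF linear4, unfolded real_scaleR_def]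
  linear_diff[OF linear1] linear_diff[OF linear2] linear_diff[OF linear3] linear_diff[OF linear4]
  linear_neg[OF linear1] linear_neg[OF linear2] linear_neg[OF linear3] linear_neg[OF linear4]
  linear_0[OF linear1] linear_0[OF linear2] linear_0[OF linear3] linear_0[OF linear4]

lemma repeat [simp]:
  "G x x z w = 0" "G x y x w = 0" "G x y z x = 0" "G x y y w = 0" "G x y z y = 0" "G x y z z = 0"
proof -
  show 12: "G x x z w = 0" for x z w using swap12[of x x z w] by simp
  show 23: "G x y y w = 0" for x y w using swap23[of x y y w] by simp
  show 34: "G x y z z = 0" for x y z using swap34[of x y z z] by simp
  show 13: "G x y x w = 0" for x y w using swap12[of x y x w] 23 by simp
  show 24: "G x y z y = 0" for x y z using swap23[of x z y y] 34 by simp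
  show "G x y z x = 0" using swap12[of x y z x] 24 by simp
qed

section \<open>Vanishing criteria for alternating functions\<close>

lemma abs_swap:
  "\<bar>G y x z w\<bar> = \<bar>G x y z w\<bar>" "\<bar>G x z y w\<bar> = \<bar>G x y z w\<bar>" "\<bar>G x y w z\<bar> = \<bar>G x y z w\<bar>"
  using swap12[of y x z w] swap23[of x z y w] swap34[of x y w z] by simp_all

text \<open>Each choice of four indices either repeats one or permutes all four. Absolute values
  forget the sign, so \<open>abs_swap\<close> can sort the arguments by ordered rewriting.\<close>

lemma eq_0_on_four:
  assumes "G e1 e2 e3 e4 = 0" and "x \<in> {e1, e2, e3, e4}" "y \<in> {e1, e2, e3, e4}"
    "z \<in> {e1, e2, e3, e4}" "w \<in> {e1, e2, e3, e4}"
  shows "G x y z w = 0"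
proof -
  have p: "\<bar>G e1 e2 e3 e4\<bar> = 0" using assms(1) by simp
  have a: "\<bar>G x x z w\<bar> = 0" "\<bar>G x z z w\<bar> = 0" "\<bar>G x z w w\<bar> = 0"
    "\<bar>G x z x w\<bar> = 0" "\<bar>G x z w x\<bar> = 0" "\<bar>G x z w z\<bar> = 0" for x z w
    by simp_all
  have c: "v = e1 \<or> v = e2 \<or> v = e3 \<or> v = e4" if "v \<in> {e1, e2, e3, e4}" for v
    using that by simp
  have "\<bar>G x y z w\<bar> = 0"
    using c[OF assms(2)] c[OF assms(3)] c[OF assms(4)] c[OF assms(5)]
    by (elim disjE) (simp_all only: a abs_swap p)
  then show ?thesis by simp
qed

text \<open>Expansion along \<open>B\<close> reduces the first slot to members of \<open>B\<close>;
  antisymmetry then brings the next slot to the front.\<close>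

lemma eq_0I:
  assumes B: "finite B" "pairwise orthogonal B" "\<And>b. b \<in> B \<Longrightarrow> norm b = 1"
    and perp: "\<And>x y z w. (\<And>b. b \<in> B \<Longrightarrow> x \<bullet> b = 0) \<Longrightarrow> G x y z w = 0"
    and basis: "\<And>x y z w. x \<in> B \<Longrightarrow> y \<in> B \<Longrightarrow> z \<in> B \<Longrightarrow> w \<in> B \<Longrightarrow> G x y z w = 0"
  shows "G x y z w = 0"
proof -
  have e: "G x y z w = 0" if "\<And>b. b \<in> B \<Longrightarrow> G b y z w = 0" for x y z w
  proof -
    have "G x y z w = (\<Sum>b\<in>B. (x \<bullet> b) * G b y z w)"
      by (rule orthonormal_linear_expansion[OF linear1 B]) (assumption | rule perp)+
    also have "\<dots> = 0" by (intro sum.neutral ballI) (simp only: that mult_zero_right)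
    finally show ?thesis .
  qed
  \<comment> \<open>The fact numbered \<open>k\<close> leaves the first \<open>k\<close> slots
    arbitrary and asks for members of \<open>B\<close> in the others.\<close>
  have 1: "G x y z w = 0" if "y \<in> B" "z \<in> B" "w \<in> B" for x y z w
    by (rule e) (rule basis, assumption, (rule that)+)
  have 2: "G x y z w = 0" if "z \<in> B" "w \<in> B" for x y z w
  proof (rule e)
    fix b assume "b \<in> B"
    from 1[OF this that, of y] show "G b y z w = 0" using swap12[of b y z w] by simp
  qed
  have 3: "G x y z w = 0" if "w \<in> B" for x y z w
  proof (rule e)
    fix b assume "b \<in> B"
    from 2[OF this that, of y z] show "G b y z w = 0"
      using swap12[of b y z w] swap23[of y b z w] by simp
  qed
  show ?thesis
  proof (rule e)
    fix b assume "b \<in> B"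
    from 3[OF this, of y z w] show "G b y z w = 0"
      using swap12[of b y z w] swap23[of y b z w] swap34[of y z b w] by simp
  qed
qed

text \<open>By linearity the last three slots can be filled from \<open>B\<close> or from its
  orthogonal complement, and antisymmetry sorts them. The facts \<open>4\<close> to \<open>1\<close>
  are named after the number of arguments from \<open>B\<close>.\<close>

lemma eq_0_on_subspace:
  assumes B: "finite B" "pairwise orthogonal B" "\<And>b. b \<in> B \<Longrightarrow> norm b = 1"
    and 4: "\<And>x y z w. x \<in> B \<Longrightarrow> y \<in> B \<Longrightarrow> z \<in> B \<Longrightarrow> w \<in> B \<Longrightarrow> G x y z w = 0"
    and 3: "\<And>x y z w. x \<in> B \<Longrightarrow> y \<in> B \<Longrightarrow> z \<in> B \<Longrightarrow> (\<And>b. b \<in> B \<Longrightarrow> w \<bullet> b = 0) \<Longrightarrow> G x y z w = 0"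
    and 2: "\<And>x y z w. x \<in> B \<Longrightarrow> y \<in> B \<Longrightarrow> (\<And>b. b \<in> B \<Longrightarrow> z \<bullet> b = 0) \<Longrightarrow>
      (\<And>b. b \<in> B \<Longrightarrow> w \<bullet> b = 0) \<Longrightarrow> G x y z w = 0"
    and 1: "\<And>x y z w. x \<in> B \<Longrightarrow> (\<And>b. b \<in> B \<Longrightarrow> y \<bullet> b = 0) \<Longrightarrow> (\<And>b. b \<in> B \<Longrightarrow> z \<bullet> b = 0) \<Longrightarrow>
      (\<And>b. b \<in> B \<Longrightarrow> w \<bullet> b = 0) \<Longrightarrow> G x y z w = 0"
    and x: "x \<in> B"
  shows "G x y z w = 0"
proof -
  define W where "W = {v. \<forall>b\<in>B. v \<bullet> b = 0}"
  have extend: "f v = 0"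
    if "linear f" "\<And>b. b \<in> B \<Longrightarrow> f b = 0" "\<And>v. v \<in> W \<Longrightarrow> f v = 0" for f :: "'a \<Rightarrow> real" and v
    using linear_eq_0_on_orthogonal_sum[OF that(1) B that(2) that(3)] by (simp add: W_def)
  note 4 = 4[OF x]
  have 3: "G x y z w = 0" if "y \<in> B" "z \<in> B" "w \<in> W" for y z w
    using 3[OF x] that by (simp add: W_def)
  have 2: "G x y z w = 0" if "y \<in> B" "z \<in> W" "w \<in> W" for y z w
    using 2[OF x] that by (simp add: W_def)
  have 1: "G x y z w = 0" if "y \<in> W" "z \<in> W" "w \<in> W" for y z w
    using 1[OF x] that by (simp add: W_def)
  have a: "G x y z w = 0" if "z \<in> W" "w \<in> W" for y z w
    by (rule extend[OF linear2]) (rule 2 1; (rule that | assumption))+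
  have b: "G x y z w = 0" if "y \<in> B" "w \<in> W" for y z w
    by (rule extend[OF linear3]) (rule 3 2; (rule that | assumption))+
  have c: "G x y z w = 0" if "w \<in> W" for y z w
  proof (rule extend[OF linear2])
    fix y assume "y \<in> B"
    then show "G x y z w = 0" using b that by blast
  next
    fix y assume "y \<in> W"
    then have "G x z y w = 0" using a[OF _ that] by blast
    then show "G x y z w = 0" using swap23[of x y z w] by simp
  qed
  have d: "G x y z w = 0" if "y \<in> B" "z \<in> B" for y z w
    by (rule extend[OF linear4]) (rule 4 3; (rule that | assumption))+
  have e: "G x y z w = 0" if "y \<in> B" for y z w
  proof (rule extend[OF linear3])
    fix z assume "z \<in> B"
    then show "G x y z w = 0" using d that by blast
  next
    fix z assume "z \<in> W"
    then have "G x y w z = 0" using c by blast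
    then show "G x y z w = 0" using swap34[of x y z w] by simp
  qed
  show ?thesis
  proof (rule extend[OF linear2])
    fix y assume "y \<in> B"
    then show "G x y z w = 0" by (rule e)
  next
    fix y assume "y \<in> W"
    then have "G x z w y = 0" using c by blast
    then show "G x y z w = 0" using swap34[of x z y w] swap23[of x y z w] by simp
  qed
qed

section \<open>The 3-bracket dual to the four-linear function\<close>

definition br :: "'a \<Rightarrow> 'a \<Rightarrow> 'a \<Rightarrow> 'a" where
  "br x y z = (\<Sum>b\<in>Basis. G x y z b *\<^sub>R b)"

lemma br_inner: "br x y z \<bullet> w = G x y z w"
proof -
  have "G x y z w = (\<Sum>b\<in>Basis. (w \<bullet> b) * G x y z b)"
    by (rule linear_Basis_expansion[OF linear4])
  then show ?thesis
    by (simp add: br_def inner_sum_left mult.commute inner_commute[of w])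
qed

lemma br_eqI: "(\<And>w. G x y z w = v \<bullet> w) \<Longrightarrow> br x y z = v"
  by (metis br_inner vector_eq_rdot)

lemma br_linear: "linear (br x y)"
  by (intro linearI; rule br_eqI) (simp_all add: multilinear inner_add_left br_inner)

lemma br_swap12: "br y x z = - br x y z"
  and br_swap23: "br x z y = - br x y z"
  by (rule br_eqI, simp add: br_inner swap12[of y x] swap23[of x z y])+

lemma br_multilinear:
  "br (x + x') y z = br x y z + br x' y z" "br (r *\<^sub>R x) y z = r *\<^sub>R br x y z" "br (- x) y z = - br x y z"
  "br x (y + y') z = br x y z + br x y' z" "br x (r *\<^sub>R y) z = r *\<^sub>R br x y z" "br x (- y) z = - br x y z"
  "br x y (z + z') = br x y z + br x y z'" "br x y (r *\<^sub>R z) = r *\<^sub>R br x y z" "br x y (- z) = - br x y z"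
  "br 0 y z = 0" "br x 0 z = 0" "br x y 0 = 0" "br x x z = 0" "br x y x = 0" "br x y y = 0"
  by (rule br_eqI, simp add: br_inner multilinear inner_add_left inner_minus_left)+

section \<open>Maximisers over unit vectors and their variations\<close>

lemma continuous: "continuous_on S (\<lambda>(x, y, z, w). G x y z w)"
proof -
  have e: "G x y z w = (\<Sum>b\<in>Basis. (x \<bullet> b) * (\<Sum>b'\<in>Basis. (y \<bullet> b') *
      (\<Sum>d\<in>Basis. (z \<bullet> d) * (\<Sum>d'\<in>Basis. (w \<bullet> d') * G b b' d d'))))" for x y z w
    by (subst linear_Basis_expansion[OF linear1], subst linear_Basis_expansion[OF linear2],
        subst linear_Basis_expansion[OF linear3], subst linear_Basis_expansion[OF linear4]) (rule refl)
  show ?thesis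
    unfolding case_prod_unfold by (subst e) (intro continuous_intros)
qed

text \<open>The bound is homogeneous in each argument, so it applies to test vectors that are not
  normalised.\<close>

definition maximal :: "'a \<Rightarrow> 'a \<Rightarrow> 'a \<Rightarrow> 'a \<Rightarrow> bool" where
  "maximal e1 e2 e3 e4 \<longleftrightarrow>
     norm e1 = 1 \<and> norm e2 = 1 \<and> norm e3 = 1 \<and> norm e4 = 1 \<and> 0 < G e1 e2 e3 e4 \<and>
     (\<forall>x y z w. G x y z w \<le> G e1 e2 e3 e4 * (norm x * norm y * norm z * norm w))"

text \<open>A maximum over the compact product of closed unit balls extends to all vectors by
  homogeneity. As it is positive, the bound at the maximiser itself forces all four norms to be
  1.\<close>

lemma maximal_exists:
  assumes "G x0 y0 z0 w0 \<noteq> 0"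
  obtains e1 e2 e3 e4 where "maximal e1 e2 e3 e4"
proof -
  define K where "K = cball (0::'a) 1 \<times> cball (0::'a) 1 \<times> cball (0::'a) 1 \<times> cball (0::'a) 1"
  have "compact K" unfolding K_def by (intro compact_Times compact_cball)
  moreover have "K \<noteq> {}" unfolding K_def by auto
  ultimately obtain p where "p \<in> K" "\<forall>q\<in>K. (\<lambda>(x, y, z, w). G x y z w) q \<le> (\<lambda>(x, y, z, w). G x y z w) p"
    using continuous_attains_sup[OF _ _ continuous] by blast
  then obtain e1 e2 e3 e4 where n: "norm e1 \<le> 1" "norm e2 \<le> 1" "norm e3 \<le> 1" "norm e4 \<le> 1"
    and max: "\<And>x y z w. norm x \<le> 1 \<Longrightarrow> norm y \<le> 1 \<Longrightarrow> norm z \<le> 1 \<Longrightarrow> norm w \<le> 1 \<Longrightarrow>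
      G x y z w \<le> G e1 e2 e3 e4"
    by (cases p) (auto simp: K_def)
  have bound: "G x y z w \<le> G e1 e2 e3 e4 * (norm x * norm y * norm z * norm w)" for x y z w
  proof (cases "x = 0 \<or> y = 0 \<or> z = 0 \<or> w = 0")
    case True
    then show ?thesis by (auto simp: multilinear)
  next
    case False
    have "G (inverse (norm x) *\<^sub>R x) (inverse (norm y) *\<^sub>R y) (inverse (norm z) *\<^sub>R z) (inverse (norm w) *\<^sub>R w)
        \<le> G e1 e2 e3 e4"
      using False by (intro max) simp_all
    with False show ?thesis by (simp add: multilinear field_simps)
  qed
  \<comment> \<open>Negating one argument negates \<open>G\<close>, so some value is
    positive.\<close>
  have "G x0 y0 z0 w0 > 0 \<or> G (- x0) y0 z0 w0 > 0"
    using assms by (auto simp: multilinear)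
  then obtain x1 where "G x1 y0 z0 w0 > 0" by blast
  then have "G e1 e2 e3 e4 * (norm x1 * norm y0 * norm z0 * norm w0) > 0"
    using bound less_le_trans by blast
  then have pos: "G e1 e2 e3 e4 > 0"
    by (metis mult_le_0_iff norm_ge_zero not_less zero_le_mult_iff)
  have "G e1 e2 e3 e4 * 1 \<le> G e1 e2 e3 e4 * (norm e1 * norm e2 * norm e3 * norm e4)"
    using bound[of e1 e2 e3 e4] by simp
  then have prod: "1 \<le> norm e1 * norm e2 * norm e3 * norm e4" using pos by simp
  have le: "1 \<le> a" "1 \<le> b" if "1 \<le> a * b" "0 \<le> a" "a \<le> 1" "0 \<le> b" "b \<le> 1" for a b :: real
    using that mult_left_le[of b a] mult_left_le_one_le[of b a] by linarith+
  have c: "norm e1 * norm e2 \<le> 1" "norm e1 * norm e2 * norm e3 \<le> 1"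
    using n by (simp_all add: mult_le_one)
  note le3 = le[OF prod _ c(2) _ n(4)]
  note le2 = le[OF le3(1) _ c(1) _ n(3)]
  note le1 = le[OF le2(1) _ n(1) _ n(2)]
  have "1 \<le> norm e1" "1 \<le> norm e2" "1 \<le> norm e3" "1 \<le> norm e4"
    by (rule le1 le2 le3; simp)+
  then have "maximal e1 e2 e3 e4"
    unfolding maximal_def using n pos bound by (auto intro: antisym)
  then show thesis ..
qed

text \<open>Double transpositions are even and keep the value of \<open>G\<close>. Together with the
  identity they bring any of the four vectors to the last place.\<close>

lemma maximal_relabel:
  assumes "maximal e1 e2 e3 e4"
  shows "maximal e2 e1 e4 e3" "maximal e3 e4 e1 e2" "maximal e4 e3 e2 e1"
proof -
  have "G e2 e1 e4 e3 = G e1 e2 e3 e4" "G e3 e4 e1 e2 = G e1 e2 e3 e4" "G e4 e3 e2 e1 = G e1 e2 e3 e4"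
    by (metis swap12 swap23 swap34 minus_minus)+
  then show "maximal e2 e1 e4 e3" "maximal e3 e4 e1 e2" "maximal e4 e3 e2 e1"
    using assms unfolding maximal_def by metis+
qed

text \<open>Testing the bound at the bracket \<open>v\<close> gives |v| <= c, while the component of
  \<open>v\<close> along the unit vector \<open>e4\<close> is already \<open>c\<close>. This is
  equality in Cauchy-Schwarz.\<close>

lemma maximal_br:
  assumes "maximal e1 e2 e3 e4"
  shows "br e1 e2 e3 = G e1 e2 e3 e4 *\<^sub>R e4"
proof -
  define c v where "c = G e1 e2 e3 e4" and "v = br e1 e2 e3"
  have m: "norm e1 = 1" "norm e2 = 1" "norm e3 = 1" "norm e4 = 1" "0 < c"
    using assms by (simp_all add: maximal_def c_def)
  have "G e1 e2 e3 v \<le> c * (norm e1 * norm e2 * norm e3 * norm v)"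
    using assms unfolding maximal_def c_def by blast
  then have "v \<bullet> v \<le> c * norm v" using m by (simp add: br_inner v_def)
  then have "norm v * norm v \<le> c * norm v" by (simp add: dot_square_norm power2_eq_square)
  then have "norm v \<le> c" using m(5) by (cases "norm v = 0") simp_all
  then have "v \<bullet> v \<le> c * c" unfolding dot_square_norm power2_eq_square by (intro mult_mono) (use m(5) in simp_all)
  moreover have "v \<bullet> e4 = c" by (simp add: v_def c_def br_inner)
  moreover have "e4 \<bullet> e4 = 1" using m(4) by (simp only: norm_eq_1)
  ultimately have "(v - c *\<^sub>R e4) \<bullet> (v - c *\<^sub>R e4) \<le> 0"
    by (simp add: inner_diff_left inner_diff_right inner_commute[of e4 v])
  then have "v - c *\<^sub>R e4 = 0" by (metis inner_eq_zero_iff inner_ge_zero antisym)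
  then show ?thesis by (simp add: v_def c_def)
qed

text \<open>By \<open>maximal_br\<close> the last vector is proportional to the bracket of the other
  three, which alternation makes orthogonal to each of them.\<close>

lemma maximal_orthogonal:
  assumes "maximal e1 e2 e3 e4"
  shows "e1 \<bullet> e2 = 0" "e1 \<bullet> e3 = 0" "e1 \<bullet> e4 = 0" "e2 \<bullet> e3 = 0" "e2 \<bullet> e4 = 0" "e3 \<bullet> e4 = 0"
proof -
  have *: "d \<bullet> a = 0 \<and> d \<bullet> b = 0 \<and> d \<bullet> c = 0" if m: "maximal a b c d" for a b c d
  proof -
    have "G a b c d * (d \<bullet> x) = G a b c x" for x
      using arg_cong[OF maximal_br[OF m], of "\<lambda>v. v \<bullet> x"] by (simp add: br_inner)
    from this[of a] this[of b] this[of c] show ?thesis using m by (simp add: maximal_def)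
  qed
  from *[OF assms] maximal_relabel[OF assms, THEN *]
  show "e1 \<bullet> e2 = 0" "e1 \<bullet> e3 = 0" "e1 \<bullet> e4 = 0" "e2 \<bullet> e3 = 0" "e2 \<bullet> e4 = 0" "e3 \<bullet> e4 = 0"
    by (simp_all add: inner_commute)
qed

text \<open>The bound is applied to the vectors \<open>ei + t wi\<close>. Orthogonality of
  \<open>wi\<close> to \<open>ei\<close> makes their norms 1 + O(t^2) and kills the terms linear in
  \<open>t\<close>; the coefficients of t^2 are then compared.\<close>

lemma maximal_second_variation:
  assumes m: "maximal e1 e2 e3 e4"
    and w: "w1 \<bullet> e1 = 0" "w2 \<bullet> e2 = 0" "w3 \<bullet> e3 = 0" "w4 \<bullet> e4 = 0"
  shows "G w1 w2 e3 e4 + G w1 e2 w3 e4 + G w1 e2 e3 w4 + G e1 w2 w3 e4 + G e1 w2 e3 w4 + G e1 e2 w3 w4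
    \<le> G e1 e2 e3 e4 / 2 * (w1 \<bullet> w1 + w2 \<bullet> w2 + w3 \<bullet> w3 + w4 \<bullet> w4)"
proof -
  define c where "c = G e1 e2 e3 e4"
  define q where "q = G w1 w2 e3 e4 + G w1 e2 w3 e4 + G w1 e2 e3 w4 + G e1 w2 w3 e4 + G e1 w2 e3 w4 + G e1 e2 w3 w4"
  define r where "r = G w1 w2 w3 e4 + G w1 w2 e3 w4 + G w1 e2 w3 w4 + G e1 w2 w3 w4"
  define s where "s = G w1 w2 w3 w4"
  define a where "a = w1 \<bullet> w1 / 2"
  define b where "b = w2 \<bullet> w2 / 2"
  define d where "d = w3 \<bullet> w3 / 2"
  define h where "h = w4 \<bullet> w4 / 2"
  \<comment> \<open>The remainder beyond second order in the difference of both sides, divided by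
    t^3.\<close>
  define g where "g t = - r + t * (c * (a * b + a * d + a * h + b * d + b * h + d * h) - s)
      + t ^ 3 * c * (a * b * d + a * b * h + a * d * h + b * d * h) + t ^ 5 * c * (a * b * d * h)" for t
  \<comment> \<open>The functional \<open>G e1 e2 e3\<close> is \<open>c\<close> times the inner
    product with \<open>e4\<close>, and likewise in the other slots.\<close>
  have lin: "G w1 e2 e3 e4 = 0" "G e1 w2 e3 e4 = 0" "G e1 e2 w3 e4 = 0" "G e1 e2 e3 w4 = 0"
  proof -
    have *: "G x y z v = 0" if "maximal x y z w" "v \<bullet> w = 0" for x y z w v
      using maximal_br[OF that(1)] that(2) by (metis br_inner inner_commute inner_scaleR_right mult_zero_right)
    show "G w1 e2 e3 e4 = 0" "G e1 w2 e3 e4 = 0" "G e1 e2 w3 e4 = 0" "G e1 e2 e3 w4 = 0"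
      using *[OF m w(4)] *[OF maximal_relabel(1)[OF m] w(3)] *[OF maximal_relabel(2)[OF m] w(2)]
        *[OF maximal_relabel(3)[OF m] w(1)]
      by (metis swap12 swap23 swap34 neg_equal_0_iff_equal)+
  qed
  \<comment> \<open>The estimate 2 n <= 1 + n^2 for the norm n replaces a square root by a
    polynomial.\<close>
  have norm_le: "norm (e + t *\<^sub>R v) \<le> 1 + t\<^sup>2 * (v \<bullet> v / 2)" if "norm e = 1" "v \<bullet> e = 0" for e v :: 'a and t
  proof -
    have "e \<bullet> e = 1" "e \<bullet> v = 0" using that by (simp_all add: norm_eq_1 inner_commute)
    then have "norm (e + t *\<^sub>R v) ^ 2 = 1 + t\<^sup>2 * (v \<bullet> v)"
      using that(2)
      unfolding power2_norm_eq_inner inner_add_left inner_add_right inner_scaleR_left inner_scaleR_right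
      by (simp only: power2_eq_square mult_zero_right add_0_left add_0_right mult.assoc)
    moreover have "2 * norm (e + t *\<^sub>R v) \<le> 1 + norm (e + t *\<^sub>R v) ^ 2"
      using sum_squares_bound[of 1 "norm (e + t *\<^sub>R v)"] by simp
    ultimately show ?thesis by simp
  qed
  have n: "norm e1 = 1" "norm e2 = 1" "norm e3 = 1" "norm e4 = 1" "0 < c"
    using m by (simp_all add: maximal_def c_def)
  have bound: "G x y z w \<le> c * (norm x * norm y * norm z * norm w)" for x y z w
    using m unfolding maximal_def c_def by blast
  have nonneg: "0 \<le> t\<^sup>2 * (c * (a + b + d + h) - q + t * g t)" for t
  proof -
    have "c + t\<^sup>2 * q + t ^ 3 * r + t ^ 4 * s
        = G (e1 + t *\<^sub>R w1) (e2 + t *\<^sub>R w2) (e3 + t *\<^sub>R w3) (e4 + t *\<^sub>R w4)"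
      unfolding multilinear lin c_def q_def r_def s_def by (simp add: algebra_simps eval_nat_numeral)
    also have "\<dots> \<le> c * (norm (e1 + t *\<^sub>R w1) * norm (e2 + t *\<^sub>R w2) * norm (e3 + t *\<^sub>R w3) * norm (e4 + t *\<^sub>R w4))"
      by (rule bound)
    also have "\<dots> \<le> c * ((1 + t\<^sup>2 * a) * (1 + t\<^sup>2 * b) * (1 + t\<^sup>2 * d) * (1 + t\<^sup>2 * h))"
      using n w unfolding a_def b_def d_def h_def
      by (intro mult_left_mono mult_mono norm_le mult_nonneg_nonneg) simp_all
    also have "\<dots> = c + t\<^sup>2 * q + t ^ 3 * r + t ^ 4 * s + t\<^sup>2 * (c * (a + b + d + h) - q + t * g t)"
      unfolding g_def by (simp add: algebra_simps eval_nat_numeral)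
    finally show ?thesis by simp
  qed
  \<comment> \<open>Division by t^2 > 0 and the limit from the right at 0 leave the second-order
    coefficient.\<close>
  have "isCont g t" for t unfolding g_def by (intro continuous_intros)
  then have "((\<lambda>t. c * (a + b + d + h) - q + t * g t) \<longlongrightarrow> c * (a + b + d + h) - q + 0 * g 0) (at_right 0)"
    by (intro tendsto_intros) (meson isCont_def filterlim_at_split)
  moreover have "eventually (\<lambda>t. 0 \<le> c * (a + b + d + h) - q + t * g t) (at_right 0)"
    using eventually_at_right_less[of "0::real"]
    by eventually_elim (use nonneg in \<open>metis zero_le_mult_iff zero_less_power2 less_irrefl not_less\<close>)
  ultimately have "0 \<le> c * (a + b + d + h) - q + 0 * g 0"
    by (rule tendsto_lowerbound) simp
  then show ?thesis by (simp add: q_def a_def b_def d_def h_def c_def algebra_simps add_divide_distrib)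
qed

end

lemma alternating4_diff:
  assumes "alternating4 G" "alternating4 H"
  shows "alternating4 (\<lambda>x y z w. G x y z w - H x y z w)"
proof -
  interpret G: alternating4 G by fact
  interpret H: alternating4 H by fact
  show ?thesis
  proof (rule alternating4.intro)
    fix x y z w
    show "linear (\<lambda>x. G x y z w - H x y z w)"
      by (rule linear_compose_sub[OF G.linear1 H.linear1])
    show "G y x z w - H y x z w = - (G x y z w - H x y z w)"
      "G x z y w - H x z y w = - (G x y z w - H x y z w)"
      "G x y w z - H x y w z = - (G x y z w - H x y z w)"
      using G.swap12[of y x z w] G.swap23[of x z y w] G.swap34[of x y w z]
        H.swap12[of y x z w] H.swap23[of x z y w] H.swap34[of x y w z] by simp_all
  qed
qed

section \<open>Euclidean 3-Lie algebras\<close>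

text \<open>The derivation rule is stated for the four-linear function, matching the invariance
  condition on \<open>F\<close>; skewness converts it into the bracket version
  \<open>br_br\<close>.\<close>

locale metric_three_lie = alternating4 +
  assumes derivation: "G (br X Y x) y z w + G x (br X Y y) z w + G x y (br X Y z) w + G x y z (br X Y w) = 0"
begin

section \<open>Bracket identities and vanishing off the maximising 4-plane\<close>

lemma br_skew: "br x y u \<bullet> v = - (u \<bullet> br x y v)"
  by (simp add: br_inner swap34[of x y u v] inner_commute[of u])

lemma br_br: "br X Y (br x y z) = br (br X Y x) y z + br x (br X Y y) z + br x y (br X Y z)"
proof (rule br_eqI)
  fix w
  have "G X Y (br x y z) w = - G x y z (br X Y w)"
    using br_skew[of X Y "br x y z" w] by (simp only: br_inner)
  then show "G X Y (br x y z) w = (br (br X Y x) y z + br x (br X Y y) z + br x y (br X Y z)) \<bullet> w"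
    using derivation[of X Y x y z w] by (simp add: inner_add_left br_inner)
qed

text \<open>On \<open>span {e1, e2, e3, e4}\<close> the maps \<open>br ei ej\<close> are multiples of the generators of
  \<open>so(4)\<close>, so by the derivation property they satisfy its commutation relations everywhere.\<close>

lemma maximal_br_br:
  assumes m: "maximal e1 e2 e3 e4"
  defines "c \<equiv> G e1 e2 e3 e4"
  shows "2 * (br e1 e4 (br e3 e1 u) \<bullet> br e1 e2 u) =
    c * ((norm (br e3 e1 u))\<^sup>2 + (norm (br e1 e2 u))\<^sup>2 - (norm (br e1 e4 u))\<^sup>2)"
proof -
  have m': "maximal e2 e1 e4 e3" "maximal e3 e4 e1 e2" "maximal e4 e3 e2 e1"
    by (rule maximal_relabel[OF m])+
  have c: "G e2 e1 e4 e3 = c" "G e3 e4 e1 e2 = c" "G e4 e3 e2 e1 = c"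
    unfolding c_def by (metis swap12 swap23 swap34 minus_minus)+
  have e: "br e3 e1 e2 = c *\<^sub>R e4" "br e1 e4 e3 = - c *\<^sub>R e2" "br e1 e4 e2 = c *\<^sub>R e3"
  proof -
    have "br e3 e1 e2 = br e1 e2 e3" by (metis br_swap12 br_swap23 minus_minus)
    then show "br e3 e1 e2 = c *\<^sub>R e4" using maximal_br[OF m] by (simp add: c_def)
    have "br e1 e4 e3 = - br e3 e4 e1" by (metis br_swap12 br_swap23 minus_minus)
    then show "br e1 e4 e3 = - c *\<^sub>R e2" using maximal_br[OF m'(2)] by (simp add: c)
    have "br e1 e4 e2 = br e2 e1 e4" by (metis br_swap12 br_swap23 minus_minus)
    then show "br e1 e4 e2 = c *\<^sub>R e3" using maximal_br[OF m'(1)] by (simp add: c)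
  qed
  define a2 a3 b1 where "a2 = br e3 e1" and "a3 = br e1 e2" and "b1 = br e1 e4"
  \<comment> \<open>Up to the factor \<open>c\<close>, the maps \<open>a2\<close>,
    \<open>a3\<close>, \<open>b1\<close> form an so(3) triple: on the span of the \<open>ei\<close>
    they rotate the three coordinate planes orthogonal to \<open>e1\<close>.\<close>
  have 1: "a2 (a3 u) = a3 (a2 u) + c *\<^sub>R b1 u"
    using br_br[of e3 e1 e1 e2 u] by (simp add: a2_def a3_def b1_def e br_multilinear)
  have 2: "b1 (a2 u) = a2 (b1 u) + c *\<^sub>R a3 u"
    using br_br[of e1 e4 e3 e1 u]
    by (simp add: a2_def a3_def b1_def e br_multilinear br_swap12[of e2 e1])
  have 3: "b1 (a3 u) = a3 (b1 u) - c *\<^sub>R a2 u"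
    using br_br[of e1 e4 e1 e2 u]
    by (simp add: a2_def a3_def b1_def e br_multilinear br_swap12[of e1 e3])
  \<comment> \<open>The same inner product is computed twice, moving \<open>b1\<close> past
    \<open>a2\<close> and past \<open>a3\<close>; the sum of the results contains the commutator of
    \<open>a2\<close> and \<open>a3\<close>.\<close>
  have "b1 (a2 u) \<bullet> a3 u = - (b1 u \<bullet> a2 (a3 u)) + c * (a3 u \<bullet> a3 u)"
    unfolding 2 inner_add_left inner_scaleR_left by (simp add: a2_def br_skew)
  moreover have "b1 (a2 u) \<bullet> a3 u = a3 (a2 u) \<bullet> b1 u + c * (a2 u \<bullet> a2 u)"
  proof -
    have "b1 (a2 u) \<bullet> a3 u = - (a2 u \<bullet> b1 (a3 u))" unfolding b1_def by (rule br_skew)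
    also have "\<dots> = - (a2 u \<bullet> a3 (b1 u)) + c * (a2 u \<bullet> a2 u)"
      unfolding 3 inner_diff_right inner_scaleR_right by simp
    also have "- (a2 u \<bullet> a3 (b1 u)) = a3 (a2 u) \<bullet> b1 u"
      unfolding a3_def br_skew by simp
    finally show ?thesis .
  qed
  ultimately have "2 * (b1 (a2 u) \<bullet> a3 u) = c * (a2 u \<bullet> a2 u + a3 u \<bullet> a3 u - b1 u \<bullet> b1 u)"
    unfolding 1 inner_add_right inner_scaleR_right
    by (simp add: inner_commute[of "b1 u" "a3 (a2 u)"] right_diff_distrib distrib_left)
  then show ?thesis unfolding a2_def a3_def b1_def power2_norm_eq_inner .
qed

text \<open>In the second variation, the terms with two of the \<open>p1\<close>, \<open>p2\<close>,
  \<open>p3\<close> become norms by \<open>maximal_br_br\<close>, and those with \<open>u\<close> by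
  skewness. The factor \<open>s\<close> stays free for a later limit.\<close>

lemma maximal_br_ineq:
  assumes m: "maximal e1 e2 e3 e4"
    and u: "u \<bullet> e1 = 0" "u \<bullet> e2 = 0" "u \<bullet> e3 = 0" "u \<bullet> e4 = 0"
  defines "N x y \<equiv> (norm (br x y u))\<^sup>2"
  shows "N e1 e2 + N e2 e3 + N e3 e1 - (N e1 e4 + N e2 e4 + N e3 e4) + 2 * s * (N e1 e2 + N e2 e3 + N e3 e1)
    \<le> (G e1 e2 e3 e4)\<^sup>2 * s\<^sup>2 * (u \<bullet> u)"
proof -
  define c where "c = G e1 e2 e3 e4"
  define p1 p2 p3 where "p1 = br e2 e3 u" and "p2 = br e3 e1 u" and "p3 = br e1 e2 u"
  have c0: "c > 0" using m by (simp add: maximal_def c_def)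
  \<comment> \<open>Cyclic permutations of the first three vectors are even, so maximality persists
    with \<open>e4\<close> last. This supplies the other two instances of
    \<open>maximal_br_br\<close>.\<close>
  have m1: "maximal e2 e3 e1 e4" and m2: "maximal e3 e1 e2 e4"
    and c1: "G e2 e3 e1 e4 = c" and c2: "G e3 e1 e2 e4 = c"
  proof -
    show 1: "G e2 e3 e1 e4 = c" and 2: "G e3 e1 e2 e4 = c"
      unfolding c_def by (metis swap12 swap23 swap34 minus_minus)+
    show "maximal e2 e3 e1 e4" "maximal e3 e1 e2 e4"
      using m unfolding maximal_def 1 2 c_def by blast+
  qed
  \<comment> \<open>Skewness moves the bracket onto the third vector, where it yields a multiple of
    \<open>e4\<close>, which is orthogonal to \<open>u\<close>.\<close>
  have p: "p1 \<bullet> e1 = 0" "p2 \<bullet> e2 = 0" "p3 \<bullet> e3 = 0"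
  proof -
    have *: "br x y u \<bullet> z = 0" if "maximal x y z e4" for x y z
      using maximal_br[OF that] u(4) by (simp add: br_skew)
    show "p1 \<bullet> e1 = 0" "p2 \<bullet> e2 = 0" "p3 \<bullet> e3 = 0"
      unfolding p1_def p2_def p3_def by (rule *; rule m m1 m2)+
  qed
  have sv: "G ((-1/c) *\<^sub>R p1) ((-1/c) *\<^sub>R p2) e3 e4 + G ((-1/c) *\<^sub>R p1) e2 ((-1/c) *\<^sub>R p3) e4
      + G ((-1/c) *\<^sub>R p1) e2 e3 (s *\<^sub>R u) + G e1 ((-1/c) *\<^sub>R p2) ((-1/c) *\<^sub>R p3) e4
      + G e1 ((-1/c) *\<^sub>R p2) e3 (s *\<^sub>R u) + G e1 e2 ((-1/c) *\<^sub>R p3) (s *\<^sub>R u)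
    \<le> c / 2 * (((-1/c) *\<^sub>R p1) \<bullet> ((-1/c) *\<^sub>R p1) + ((-1/c) *\<^sub>R p2) \<bullet> ((-1/c) *\<^sub>R p2)
      + ((-1/c) *\<^sub>R p3) \<bullet> ((-1/c) *\<^sub>R p3) + (s *\<^sub>R u) \<bullet> (s *\<^sub>R u))"
    unfolding c_def by (rule maximal_second_variation[OF m]) (simp_all add: p u)
  have t: "G p1 p2 e3 e4 = br e3 e4 p1 \<bullet> p2" "G p1 e2 p3 e4 = br e2 e4 p3 \<bullet> p1"
    "G e1 p2 p3 e4 = br e1 e4 p2 \<bullet> p3"
    unfolding br_inner by (metis swap12 swap23 swap34 minus_minus)+
  have t': "G p1 e2 e3 u = - N e2 e3" "G e1 p2 e3 u = - N e3 e1" "G e1 e2 p3 u = - N e1 e2"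
  proof -
    have *: "G x y (br x y u) u = - N x y" for x y
      by (simp add: br_inner[symmetric] br_skew N_def power2_norm_eq_inner inner_commute)
    have "G p1 e2 e3 u = G e2 e3 p1 u" "G e1 p2 e3 u = G e3 e1 p2 u"
      by (metis swap12 swap23 swap34 minus_minus)+
    with * show "G p1 e2 e3 u = - N e2 e3" "G e1 p2 e3 u = - N e3 e1" "G e1 e2 p3 u = - N e1 e2"
      unfolding p1_def p2_def p3_def by simp_all
  qed
  have r: "2 * (br e1 e4 p2 \<bullet> p3) = c * (N e3 e1 + N e1 e2 - N e1 e4)"
    "2 * (br e2 e4 p3 \<bullet> p1) = c * (N e1 e2 + N e2 e3 - N e2 e4)"
    "2 * (br e3 e4 p1 \<bullet> p2) = c * (N e2 e3 + N e3 e1 - N e3 e4)"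
    using maximal_br_br[OF m, of u] maximal_br_br[OF m1, of u] maximal_br_br[OF m2, of u]
    unfolding c1 c2 c_def[symmetric] p1_def p2_def p3_def N_def by simp_all
  have n: "p1 \<bullet> p1 = N e2 e3" "p2 \<bullet> p2 = N e3 e1" "p3 \<bullet> p3 = N e1 e2"
    unfolding p1_def p2_def p3_def N_def by (simp_all add: power2_norm_eq_inner)
  have "2 * (br e3 e4 p1 \<bullet> p2 / c\<^sup>2 + br e2 e4 p3 \<bullet> p1 / c\<^sup>2 + br e1 e4 p2 \<bullet> p3 / c\<^sup>2
      + s / c * (N e1 e2 + N e2 e3 + N e3 e1))
    \<le> (N e2 e3 + N e3 e1 + N e1 e2) / c + c * s\<^sup>2 * (u \<bullet> u)"
    using sv c0 unfolding multilinear t t' n inner_scaleR_left inner_scaleR_right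
    by (simp add: field_simps power2_eq_square)
  then have "c * (2 * (br e3 e4 p1 \<bullet> p2 / c\<^sup>2 + br e2 e4 p3 \<bullet> p1 / c\<^sup>2 + br e1 e4 p2 \<bullet> p3 / c\<^sup>2
      + s / c * (N e1 e2 + N e2 e3 + N e3 e1)))
    \<le> c * ((N e2 e3 + N e3 e1 + N e1 e2) / c + c * s\<^sup>2 * (u \<bullet> u))"
    using c0 by (intro mult_left_mono) simp_all
  also have "c * (2 * (br e3 e4 p1 \<bullet> p2 / c\<^sup>2 + br e2 e4 p3 \<bullet> p1 / c\<^sup>2 + br e1 e4 p2 \<bullet> p3 / c\<^sup>2
      + s / c * (N e1 e2 + N e2 e3 + N e3 e1)))
    = (2 * (br e3 e4 p1 \<bullet> p2) + 2 * (br e2 e4 p3 \<bullet> p1) + 2 * (br e1 e4 p2 \<bullet> p3)) / c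
      + 2 * s * (N e1 e2 + N e2 e3 + N e3 e1)"
    using c0 by (simp add: field_simps power2_eq_square)
  also have "c * ((N e2 e3 + N e3 e1 + N e1 e2) / c + c * s\<^sup>2 * (u \<bullet> u))
    = N e2 e3 + N e3 e1 + N e1 e2 + c\<^sup>2 * s\<^sup>2 * (u \<bullet> u)"
    using c0 by (simp add: add_divide_distrib distrib_left power2_eq_square)
  finally show ?thesis
    unfolding r c_def[symmetric] using c0 by (simp add: add_divide_distrib)
qed

lemma maximal_br_perp:
  assumes m: "maximal e1 e2 e3 e4"
    and u: "u \<bullet> e1 = 0" "u \<bullet> e2 = 0" "u \<bullet> e3 = 0" "u \<bullet> e4 = 0"
  shows "br e1 e2 u = 0" "br e2 e3 u = 0" "br e1 e3 u = 0"
proof -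
  define N where "N x y = (norm (br x y u))\<^sup>2" for x y
  define c where "c = G e1 e2 e3 e4"
  define S where "S = N e1 e2 + N e2 e3 + N e3 e1"
  have sym: "N x y = N y x" for x y by (simp add: N_def br_swap12[of x y])
  have ineq: "N x1 x2 + N x2 x3 + N x3 x1 \<le> N x1 x4 + N x2 x4 + N x3 x4"
    if "maximal x1 x2 x3 x4" "u \<bullet> x1 = 0" "u \<bullet> x2 = 0" "u \<bullet> x3 = 0" "u \<bullet> x4 = 0" for x1 x2 x3 x4
    using maximal_br_ineq[OF that, of 0] by (simp add: N_def)
  \<comment> \<open>In the sum of the four inequalities each unordered pair of indices occurs twice
    on either side, so all four are equalities.\<close>
  have "S = N e1 e4 + N e2 e4 + N e3 e4"
    unfolding S_def
    using ineq[OF m u] ineq[OF maximal_relabel(1)[OF m] u(2,1,4,3)]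
      ineq[OF maximal_relabel(2)[OF m] u(3,4,1,2)] ineq[OF maximal_relabel(3)[OF m] u(4,3,2,1)]
      sym[of e1 e2] sym[of e1 e3] sym[of e1 e4] sym[of e2 e3] sym[of e2 e4] sym[of e3 e4]
    by linarith
  then have ineq': "2 * s * S \<le> c\<^sup>2 * s\<^sup>2 * (u \<bullet> u)" for s
    using maximal_br_ineq[OF m u, of s] unfolding S_def N_def c_def by linarith
  have nonneg: "N x y \<ge> 0" for x y by (simp add: N_def)
  have "S \<le> 0"
  proof (rule ccontr)
    assume S: "\<not> S \<le> 0"
    define k where "k = c\<^sup>2 * (u \<bullet> u)"
    have k: "k \<ge> 0" by (simp add: k_def)
    \<comment> \<open>Small enough that the linear term in \<open>ineq'\<close> beats the quadratic
      one, since \<open>t * k < S\<close>. The added 1 keeps the denominator positive when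
      \<open>u = 0\<close>.\<close>
    define t where "t = S / (k + 1)"
    have "t * (k + 1) = S" using k by (simp add: t_def)
    then have t: "t > 0" "t * k + t = S" using S k by (simp_all add: t_def distrib_left)
    have "t * (2 * S) \<le> t * (k * t)"
      using ineq'[of t] by (simp add: k_def power2_eq_square mult_ac)
    then have "2 * S \<le> k * t" using t(1) by simp
    then show False using t S by (simp add: mult.commute)
  qed
  then have "N e1 e2 = 0" "N e2 e3 = 0" "N e1 e3 = 0"
    using nonneg[of e1 e2] nonneg[of e2 e3] nonneg[of e3 e1] sym[of e1 e3] unfolding S_def by linarith+
  then show "br e1 e2 u = 0" "br e2 e3 u = 0" "br e1 e3 u = 0" by (simp_all add: N_def)
qed

text \<open>These are the mixed components of \<open>G\<close>. The first two kinds vanish because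
  brackets with two arguments from \<open>A\<close> kill the complement, the third by the derivation
  rule.\<close>

lemma maximal_vanishing:
  assumes m: "maximal e1 e2 e3 e4"
  defines "A \<equiv> {e1, e2, e3, e4}"
  shows "x \<in> A \<Longrightarrow> y \<in> A \<Longrightarrow> z \<in> A \<Longrightarrow> (\<And>b. b \<in> A \<Longrightarrow> w \<bullet> b = 0) \<Longrightarrow> G x y z w = 0"
    and "x \<in> A \<Longrightarrow> y \<in> A \<Longrightarrow> (\<And>b. b \<in> A \<Longrightarrow> z \<bullet> b = 0) \<Longrightarrow> G x y z w = 0"
    and "x \<in> A \<Longrightarrow> (\<And>b. b \<in> A \<Longrightarrow> y \<bullet> b = 0) \<Longrightarrow> (\<And>b. b \<in> A \<Longrightarrow> z \<bullet> b = 0) \<Longrightarrow>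
      (\<And>b. b \<in> A \<Longrightarrow> w \<bullet> b = 0) \<Longrightarrow> G x y z w = 0"
proof -
  have m': "maximal e2 e1 e4 e3" "maximal e3 e4 e1 e2" "maximal e4 e3 e2 e1"
    by (rule maximal_relabel[OF m])+
  have br0: "br x y z = 0" if "x \<in> A" "y \<in> A" and z: "\<And>b. b \<in> A \<Longrightarrow> z \<bullet> b = 0" for x y z
  proof -
    have u: "z \<bullet> e1 = 0" "z \<bullet> e2 = 0" "z \<bullet> e3 = 0" "z \<bullet> e4 = 0" using z by (simp_all add: A_def)
    \<comment> \<open>Three of the four labellings already reach all six pairs.\<close>
    have "br e1 e2 z = 0" "br e2 e3 z = 0" "br e1 e3 z = 0"
      "br e1 e4 z = 0" "br e2 e4 z = 0" "br e3 e4 z = 0"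
      using maximal_br_perp[OF m u] maximal_br_perp[OF m'(1) u(2,1,4,3)]
        maximal_br_perp[OF m'(2) u(3,4,1,2)] by (simp_all add: br_swap12[of e4 e2])
    then show ?thesis using that(1,2)
      by (auto simp: A_def br_multilinear br_swap12[of e2 e1] br_swap12[of e3 e1] br_swap12[of e4 e1]
          br_swap12[of e3 e2] br_swap12[of e4 e2] br_swap12[of e4 e3])
  qed
  then show 2: "x \<in> A \<Longrightarrow> y \<in> A \<Longrightarrow> (\<And>b. b \<in> A \<Longrightarrow> z \<bullet> b = 0) \<Longrightarrow> G x y z w = 0" for x y z w
    using br_inner[of x y z w] by simp
  show "x \<in> A \<Longrightarrow> y \<in> A \<Longrightarrow> z \<in> A \<Longrightarrow> (\<And>b. b \<in> A \<Longrightarrow> w \<bullet> b = 0) \<Longrightarrow> G x y z w = 0"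
    using 2[of x y w z] swap34[of x y z w] by simp
  have 1: "G e4 y z w = 0"
    if m: "maximal e1 e2 e3 e4" and A: "A = {e1, e2, e3, e4}"
      and p: "\<And>b. b \<in> A \<Longrightarrow> y \<bullet> b = 0" "\<And>b. b \<in> A \<Longrightarrow> z \<bullet> b = 0" "\<And>b. b \<in> A \<Longrightarrow> w \<bullet> b = 0"
    for e1 e2 e3 e4 y z w
  proof -
    have "br e1 e2 y = 0" "br e1 e2 z = 0" "br e1 e2 w = 0"
      by (rule br0; (rule p, assumption | simp add: A))+
    \<comment> \<open>\<open>br e1 e2\<close> annihilates \<open>y\<close>, \<open>z\<close> and
      \<open>w\<close>, so only the term at \<open>e3\<close> survives in the derivation
      rule.\<close>
    then have "G (G e1 e2 e3 e4 *\<^sub>R e4) y z w = 0"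
      using derivation[of e1 e2 e3 y z w] by (simp add: multilinear maximal_br[OF m])
    then show ?thesis using m by (simp add: multilinear maximal_def)
  qed
  assume p: "x \<in> A" "\<And>b. b \<in> A \<Longrightarrow> y \<bullet> b = 0" "\<And>b. b \<in> A \<Longrightarrow> z \<bullet> b = 0" "\<And>b. b \<in> A \<Longrightarrow> w \<bullet> b = 0"
  have "G e1 y z w = 0" "G e2 y z w = 0" "G e3 y z w = 0" "G e4 y z w = 0"
    by (rule 1, rule m m', force simp: A_def, (rule p, assumption)+)+
  then show "G x y z w = 0" using p(1) by (auto simp: A_def)
qed

end

section \<open>Invariance as the derivation property\<close>

lemma interior_product_forms:
  assumes "\<Omega> \<in> forms (Suc p)"
  shows "interior_product v \<Omega> \<in> forms p"
proof -
  have 1: "\<And>xs. length xs \<noteq> Suc p \<Longrightarrow> \<Omega> xs = 0"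
    and 2: "\<And>xs i. length xs = Suc p \<Longrightarrow> i < Suc p \<Longrightarrow> linear (\<lambda>v. \<Omega> (xs[i := v]))"
    and 3: "\<And>xs i j. length xs = Suc p \<Longrightarrow> i < j \<Longrightarrow> j < Suc p \<Longrightarrow> xs ! i = xs ! j \<Longrightarrow> \<Omega> xs = 0"
    using assms unfolding forms_def by blast+
  show ?thesis
    unfolding forms_def interior_product_def
  proof (intro CollectI conjI allI impI)
    show "\<Omega> (v # xs) = 0" if "length xs \<noteq> p" for xs using that by (simp add: 1)
    show "linear (\<lambda>u. \<Omega> (v # xs[i := u]))" if "length xs = p" "i < p" for xs i
      using 2[of "v # xs" "Suc i"] that by simp
    show "\<Omega> (v # xs) = 0" if "length xs = p" "i < j" "j < p" "xs ! i = xs ! j" for xs i j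
      using 3[of "v # xs" "Suc i" "Suc j"] that by simp
  qed
qed

text \<open>\<open>form_swap\<close> exchanges the two leading arguments only; interior products
  bring later pairs to the front.\<close>

lemma alternating4_form:
  fixes F :: "'a::euclidean_space list \<Rightarrow> real"
  assumes "F \<in> forms 4"
  shows "alternating4 (\<lambda>x y z w. F [x, y, z, w])"
proof (rule alternating4.intro)
  have 3: "interior_product x F \<in> forms 3" for x
    using interior_product_forms[of F 3 x] assms by simp
  then have 2: "interior_product y (interior_product x F) \<in> forms 2" for x y
    using interior_product_forms[of _ 2 y] by simp
  fix x y z w
  show "linear (\<lambda>x. F [x, y, z, w])" by (rule form_linear_head(1)[OF assms])
  show "F [y, x, z, w] = - F [x, y, z, w]" by (rule form_swap[OF assms])
  show "F [x, z, y, w] = - F [x, y, z, w]"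
    using form_swap[OF 3, of x y z "[w]"] by (simp add: interior_product_def)
  show "F [x, y, w, z] = - F [x, y, z, w]"
    using form_swap[OF 2, of y x z w "[]"] by (simp add: interior_product_def)
qed

text \<open>One basis sum rebuilds \<open>T\<close> from \<omega>, the other expands the form, and
  antisymmetry absorbs the factor 1/2. This turns the action into a derivation.\<close>

lemma action_form4:
  assumes \<omega>: "\<omega> \<in> forms 2" and \<Omega>: "\<Omega> \<in> forms 4" and T: "\<And>v w. T v \<bullet> w = \<omega> [v, w]"
  shows "action \<omega> \<Omega> [x, y, z, w] =
    \<Omega> [T x, y, z, w] + \<Omega> [x, T y, z, w] + \<Omega> [x, y, T z, w] + \<Omega> [x, y, z, T w]"
proof -
  interpret alternating4 "\<lambda>x y z w. \<Omega> [x, y, z, w]" by (rule alternating4_form[OF \<Omega>])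
  define h where "h b c = wedge (blinfun_inner_left b) (interior_product c \<Omega>) [x, y, z, w]" for b c
  have h: "h b c = (x \<bullet> b) * \<Omega> [c, y, z, w] - (y \<bullet> b) * \<Omega> [c, x, z, w]
      + (z \<bullet> b) * \<Omega> [c, x, y, w] - (w \<bullet> b) * \<Omega> [c, x, y, z]" for b c
    by (simp add: h_def wedge_Cons interior_product_def)
  have t: "(\<Sum>b\<in>Basis. \<Sum>c\<in>Basis. \<omega> [b, c] * ((v \<bullet> b) * f c)) = f (T v)"
    if f: "linear f" for f :: "'a \<Rightarrow> real" and v
  proof -
    have "(\<Sum>b\<in>Basis. \<Sum>c\<in>Basis. \<omega> [b, c] * ((v \<bullet> b) * f c))
        = (\<Sum>c\<in>Basis. (\<Sum>b\<in>Basis. (v \<bullet> b) * \<omega> [b, c]) * f c)"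
      by (subst sum.swap) (simp add: sum_distrib_left sum_distrib_right mult_ac)
    also have "\<dots> = (\<Sum>c\<in>Basis. (T v \<bullet> c) * f c)"
      by (simp only: T linear_Basis_expansion[OF form_linear_head(1)[OF \<omega>], of v, symmetric])
    also have "\<dots> = f (T v)" by (rule linear_Basis_expansion[OF f, symmetric])
    finally show ?thesis .
  qed
  have "action \<omega> \<Omega> [x, y, z, w] = 1/2 * (\<Sum>b\<in>Basis. \<Sum>c\<in>Basis. \<omega> [b, c] * (h b c - h c b))"
    by (simp add: action_def wedge_action_def h_def)
  also have "\<dots> = (\<Sum>b\<in>Basis. \<Sum>c\<in>Basis. \<omega> [b, c] * h b c)"
    by (rule antisymmetric_sum) (rule form_swap[OF \<omega>], simp)
  also have "\<dots> = \<Omega> [T x, y, z, w] - \<Omega> [T y, x, z, w] + \<Omega> [T z, x, y, w] - \<Omega> [T w, x, y, z]"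
    unfolding h distrib_left right_diff_distrib sum.distrib sum_subtractf
    by (simp only: t[OF linear1])
  also have "\<dots> = \<Omega> [T x, y, z, w] + \<Omega> [x, T y, z, w] + \<Omega> [x, y, T z, w] + \<Omega> [x, y, z, T w]"
    using swap12[of "T y" x z w] swap12[of "T z" x y w] swap23[of x "T z" y w]
      swap12[of "T w" x y z] swap23[of x "T w" y z] swap34[of x y "T w" z] by simp
  finally show ?thesis .
qed

section \<open>Reduction to decomposable bivectors\<close>

lemma action_length:
  assumes "\<Omega> \<in> forms p" "length xs \<noteq> p"
  shows "action \<omega> \<Omega> xs = 0"
proof -
  have "wedge \<alpha> (interior_product v \<Omega>) xs = 0" for \<alpha> v
    unfolding wedge_def interior_product_def
    using assms(2) by (intro sum.neutral ballI) (auto intro!: form_eq_0[OF assms(1)])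
  then show ?thesis by (simp add: action_def wedge_action_def)
qed

lemma action_sum:
  "action (\<lambda>xs. \<Sum>i\<in>I. k i * \<omega> i xs) \<Omega> xs = (\<Sum>i\<in>I. k i * action (\<omega> i) \<Omega> xs)"
  unfolding action_def sum.cartesian_product case_prod_unfold
  by (simp only: sum_distrib_left sum_distrib_right, subst sum.swap) (simp only: mult_ac)

text \<open>For a decomposable bivector the contraction is F(X, Y, -, -), whose skew map is
  \<open>br X Y\<close>, so invariance is the derivation rule. Linearity of the action in the
  contracted form covers the rest.\<close>

lemma action_contract_eq_0_iff:
  fixes F :: "'a::euclidean_space list \<Rightarrow> real"
  assumes F: "F \<in> forms 4"
  shows "(\<forall>\<Xi>\<in>forms 2. action (contract \<Xi> F) F = (\<lambda>_. 0)) \<longleftrightarrow>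
    metric_three_lie (\<lambda>x y z w. F [x, y, z, w])"
proof -
  interpret alternating4 "\<lambda>x y z w. F [x, y, z, w]" by (rule alternating4_form[OF F])
  have "interior_product X F \<in> forms 3" for X
    using interior_product_forms[of F 3 X] F by simp
  then have "interior_product Y (interior_product X F) \<in> forms 2" for X Y
    using interior_product_forms[of _ 2 Y] by simp
  then have f2: "(\<lambda>xs. F (X # Y # xs)) \<in> forms 2" for X Y by (simp add: interior_product_def)
  have act: "action (\<lambda>xs. F (X # Y # xs)) F [x, y, z, w] = F [br X Y x, y, z, w] + F [x, br X Y y, z, w]
      + F [x, y, br X Y z, w] + F [x, y, z, br X Y w]" for X Y x y z w
    by (rule action_form4[OF f2 F]) (simp add: br_inner)
  show ?thesis
  proof
    assume *: "\<forall>\<Xi>\<in>forms 2. action (contract \<Xi> F) F = (\<lambda>_. 0)"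
    show "metric_three_lie (\<lambda>x y z w. F [x, y, z, w])"
    proof
      fix X Y x y z w :: 'a
      have "wedge_vectors X Y \<in> forms 2"
        unfolding wedge_vectors_def using wedge_list_forms[of "[evaluation X, evaluation Y]"]
        by (simp add: eval_nat_numeral del: wedge_list.simps)
      then have "action (contract (wedge_vectors X Y) F) F [x, y, z, w] = 0" using * by simp
      then show "F [br X Y x, y, z, w] + F [x, br X Y y, z, w]
          + F [x, y, br X Y z, w] + F [x, y, z, br X Y w] = 0"
        unfolding contract_wedge_vectors[OF F] act .
    qed
  next
    assume "metric_three_lie (\<lambda>x y z w. F [x, y, z, w])"
    then interpret metric_three_lie "\<lambda>x y z w. F [x, y, z, w]" .
    have 0: "action (\<lambda>xs. F (X # Y # xs)) F xs = 0" for X Y xs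
    proof (cases "length xs = 4")
      case True
      then obtain x y z w where "xs = [x, y, z, w]"
        by (auto simp: eval_nat_numeral length_Suc_conv)
      then show ?thesis using derivation[of X Y x y z w] by (simp add: act)
    qed (rule action_length[OF F])
    show "\<forall>\<Xi>\<in>forms 2. action (contract \<Xi> F) F = (\<lambda>_. 0)"
    proof (intro ballI ext)
      fix \<Xi> :: "('a \<Rightarrow>\<^sub>L real) list \<Rightarrow> real" and xs
      have "contract \<Xi> F = (\<lambda>xs. \<Sum>p\<in>Basis \<times> Basis.
          (1/2 * \<Xi> [blinfun_inner_left (fst p), blinfun_inner_left (snd p)]) * F (fst p # snd p # xs))"
        unfolding contract_def sum.cartesian_product case_prod_unfold
        by (simp add: sum_distrib_left mult.assoc)
      then show "action (contract \<Xi> F) F xs = 0"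
        by (simp only: action_sum 0) simp
    qed
  qed
qed

section \<open>Sums of orthogonal simple forms\<close>

context alternating4
begin

text \<open>The slotwise sum \<open>D\<close> is alternating and supported on at most four
  dimensions, so it is the trace of \<open>T\<close> times \<open>G\<close>; skew maps are
  traceless.\<close>

lemma derivation_of_skew:
  assumes B: "finite B" "pairwise orthogonal B" "\<And>b. b \<in> B \<Longrightarrow> norm b = 1" "card B \<le> 4"
    and perp: "\<And>x y z w. (\<And>b. b \<in> B \<Longrightarrow> x \<bullet> b = 0) \<Longrightarrow> G x y z w = 0"
    and T: "linear T" "\<And>v. T v \<bullet> v = 0" "\<And>x. (\<And>b. b \<in> B \<Longrightarrow> x \<bullet> b = 0) \<Longrightarrow> T x = 0"
  shows "G (T x) y z w + G x (T y) z w + G x y (T z) w + G x y z (T w) = 0"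
proof -
  define D where "D x y z w = G (T x) y z w + G x (T y) z w + G x y (T z) w + G x y z (T w)" for x y z w
  interpret D: alternating4 D
  proof (rule alternating4.intro)
    fix x y z w
    show "linear (\<lambda>x. D x y z w)"
      unfolding D_def
      by (rule linearI)
        (simp_all add: multilinear linear_add[OF T(1)] linear_scale[OF T(1)] distrib_left)
    show "D y x z w = - D x y z w" "D x z y w = - D x y z w" "D x y w z = - D x y z w"
      unfolding D_def
      by (simp_all add: swap12[of "T y" x] swap12[of y "T x"] swap12[of y x]
          swap23[of x "T z" y] swap23[of x z "T y"] swap23[of x z y] swap23[of "T x" z y]
          swap34[of x y "T w" z] swap34[of x y w "T z"] swap34[of x y w z] swap34[of "T x" y w z]
          swap34[of x "T y" w z])
  qed
  have e: "G (T x) y z w = 0" if d: "distinct [x, y, z, w]" "x \<in> B" "y \<in> B" "z \<in> B" "w \<in> B" for x y z w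
  proof -
    have "card {x, y, z, w} = 4" using d(1) by simp
    then have "B = {x, y, z, w}" using d B by (intro card_seteq[symmetric]) auto
    then have "b = x \<or> G b y z w = 0" if "b \<in> B" for b using that by auto
    then have 0: "(T x \<bullet> b) * G b y z w = 0" if "b \<in> B" for b using T(2)[of x] that by fastforce
    \<comment> \<open>Every \<open>b \<noteq> x\<close> repeats one of \<open>y, z, w\<close>, and \<open>T x\<close> has no \<open>x\<close>-component.\<close>
    have "G (T x) y z w = (\<Sum>b\<in>B. (T x \<bullet> b) * G b y z w)"
      by (rule orthonormal_linear_expansion[OF linear1 B(1-3)]) (assumption | rule perp)+
    also have "\<dots> = 0" by (intro sum.neutral ballI 0)
    finally show ?thesis .
  qed
  have "D x y z w = 0"
  proof (rule D.eq_0I[OF B(1-3)])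
    fix x y z w assume p: "\<And>b. b \<in> B \<Longrightarrow> x \<bullet> b = 0"
    have "G x y z w = 0" for y z w by (rule perp) (rule p)
    moreover have "T x = 0" by (rule T(3)) (rule p)
    ultimately show "D x y z w = 0" by (simp add: D_def multilinear)
  next
    fix x y z w assume b: "x \<in> B" "y \<in> B" "z \<in> B" "w \<in> B"
    show "D x y z w = 0"
    proof (cases "distinct [x, y, z, w]")
      case True
      have "G (T x) y z w = 0" "G (T y) x z w = 0" "G (T z) x y w = 0" "G (T w) x y z = 0"
        using True b by (intro e; auto)+
      then show ?thesis
        using swap12[of "T y" x z w] swap12[of "T z" x y w] swap23[of x "T z" y w]
          swap12[of "T w" x y z] swap23[of x "T w" y z] swap34[of x y "T w" z] by (simp add: D_def)
    qed auto
  qed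
  then show ?thesis by (simp add: D_def)
qed

end

text \<open>\<open>B\<close> is an orthonormal basis of the span of the dual vectors. The zero form
  gets the empty set, since \<open>plane\<close> has no determined value there.\<close>

lemma simple_form_orthonormal_support:
  fixes \<Omega> :: "'a::euclidean_space list \<Rightarrow> real"
  assumes "simple_form p \<Omega>"
  shows "\<exists>B. finite B \<and> pairwise orthogonal B \<and> (\<forall>b\<in>B. norm b = 1) \<and> card B \<le> p \<and>
    (\<forall>x xs. (\<forall>b\<in>B. x \<bullet> b = 0) \<longrightarrow> \<Omega> (x # xs) = 0) \<and>
    (\<Omega> = (\<lambda>_. 0) \<longrightarrow> B = {}) \<and> (\<Omega> \<noteq> (\<lambda>_. 0) \<longrightarrow> B \<subseteq> plane \<Omega>)"
proof (cases "\<Omega> = (\<lambda>_. 0)")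
  case True
  show ?thesis by (rule exI[of _ "{}"]) (simp add: True)
next
  case False
  obtain \<alpha>s where \<alpha>s: "length \<alpha>s = p" "\<Omega> = wedge_list \<alpha>s" using assms by (auto simp: simple_form_def)
  define P where "P = span (sharp ` set \<alpha>s)"
  obtain B where B: "B \<subseteq> P" "pairwise orthogonal B" "\<And>b. b \<in> B \<Longrightarrow> norm b = 1" "independent B"
    "card B = dim P" "span B = P"
    using orthonormal_basis_subspace[of P] unfolding P_def by (metis subspace_span)
  show ?thesis
  proof (intro exI[of _ B] conjI ballI allI impI)
    show "finite B" using B(4) by (rule independent_imp_finite)
    show "pairwise orthogonal B" by (rule B(2))
    show "norm b = 1" if "b \<in> B" for b using that by (rule B(3))
    have "dim P \<le> card (sharp ` set \<alpha>s)" unfolding P_def dim_span by (rule dim_le_card') simp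
    also have "\<dots> \<le> p" by (metis \<alpha>s(1) card_image_le card_length finite_set order_trans)
    finally show "card B \<le> p" by (simp add: B(5))
    show "B = {}" if "\<Omega> = (\<lambda>_. 0)" using that False by blast
    show "B \<subseteq> plane \<Omega>" using False B(1) plane_wedge_list[of \<alpha>s] by (simp add: \<alpha>s(2) P_def)
    show "\<Omega> (x # xs) = 0" if x: "\<forall>b\<in>B. x \<bullet> b = 0" for x xs
    proof -
      have "blinfun_apply \<alpha> x = 0" if "\<alpha> \<in> set \<alpha>s" for \<alpha>
      proof -
        have "sharp \<alpha> \<in> span B" unfolding B(6) P_def using that by (intro span_base) simp
        then have "orthogonal x (sharp \<alpha>)"
          by (rule orthogonal_to_span) (simp add: orthogonal_def x)
        then show ?thesis by (simp add: orthogonal_def sharp_inner[symmetric] inner_commute)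
      qed
      then have "interior_product x \<Omega> = (\<lambda>_. 0)"
        unfolding \<alpha>s(2) by (rule interior_product_wedge_list_eq_0)
      then show ?thesis by (simp add: interior_product_def fun_eq_iff)
    qed
  qed
qed

text \<open>The brackets of the two forms add up. Each annihilates the support of the other form
  and, being skew, has image orthogonal to it. So cross terms vanish, and
  \<open>derivation_of_skew\<close> settles the rest.\<close>

lemma orthogonal_simple_forms_three_lie:
  fixes F1 F2 :: "'a::euclidean_space list \<Rightarrow> real"
  assumes s: "simple_form 4 F1" "simple_form 4 F2" and orth: "orthogonal_forms F1 F2"
  shows "metric_three_lie (\<lambda>x y z w. F1 [x, y, z, w] + F2 [x, y, z, w])"
proof -
  interpret G1: alternating4 "\<lambda>x y z w. F1 [x, y, z, w]"
    by (rule alternating4_form[OF simple_form_forms[OF s(1)]])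
  interpret G2: alternating4 "\<lambda>x y z w. F2 [x, y, z, w]"
    by (rule alternating4_form[OF simple_form_forms[OF s(2)]])
  interpret G: alternating4 "\<lambda>x y z w. F1 [x, y, z, w] + F2 [x, y, z, w]"
  proof (rule alternating4.intro)
    fix x y z w
    show "linear (\<lambda>x. F1 [x, y, z, w] + F2 [x, y, z, w])"
      by (rule linear_compose_add[OF G1.linear1 G2.linear1])
    show "F1 [y, x, z, w] + F2 [y, x, z, w] = - (F1 [x, y, z, w] + F2 [x, y, z, w])"
      "F1 [x, z, y, w] + F2 [x, z, y, w] = - (F1 [x, y, z, w] + F2 [x, y, z, w])"
      "F1 [x, y, w, z] + F2 [x, y, w, z] = - (F1 [x, y, z, w] + F2 [x, y, z, w])"
      using G1.swap12[of y x z w] G1.swap23[of x z y w] G1.swap34[of x y w z]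
        G2.swap12[of y x z w] G2.swap23[of x z y w] G2.swap34[of x y w z] by simp_all
  qed
  obtain B1 where B1: "finite B1" "pairwise orthogonal B1" "\<And>b. b \<in> B1 \<Longrightarrow> norm b = 1" "card B1 \<le> 4"
    and p1: "\<And>x xs. (\<And>b. b \<in> B1 \<Longrightarrow> x \<bullet> b = 0) \<Longrightarrow> F1 (x # xs) = 0"
    and P1: "F1 = (\<lambda>_. 0) \<Longrightarrow> B1 = {}" "F1 \<noteq> (\<lambda>_. 0) \<Longrightarrow> B1 \<subseteq> plane F1"
    using simple_form_orthonormal_support[OF s(1)] by metis
  obtain B2 where B2: "finite B2" "pairwise orthogonal B2" "\<And>b. b \<in> B2 \<Longrightarrow> norm b = 1" "card B2 \<le> 4"
    and p2: "\<And>x xs. (\<And>b. b \<in> B2 \<Longrightarrow> x \<bullet> b = 0) \<Longrightarrow> F2 (x # xs) = 0"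
    and P2: "F2 = (\<lambda>_. 0) \<Longrightarrow> B2 = {}" "F2 \<noteq> (\<lambda>_. 0) \<Longrightarrow> B2 \<subseteq> plane F2"
    using simple_form_orthonormal_support[OF s(2)] by metis
  \<comment> \<open>A zero form has empty support, so the degenerate cases hold vacuously.\<close>
  have B12: "b1 \<bullet> b2 = 0" if "b1 \<in> B1" "b2 \<in> B2" for b1 b2
    using orth P1 P2 that unfolding orthogonal_forms_def by blast
  have G1_T1: "G1.br X Y x = 0" if "\<And>b. b \<in> B1 \<Longrightarrow> x \<bullet> b = 0" for X Y x
  proof (rule G1.br_eqI)
    fix w
    have "F1 [x, X, Y, w] = 0" by (rule p1) (rule that)
    then show "F1 [X, Y, x, w] = 0 \<bullet> w" using G1.swap12[of x X Y w] G1.swap23[of X x Y w] by simp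
  qed
  have G2_T2: "G2.br X Y x = 0" if "\<And>b. b \<in> B2 \<Longrightarrow> x \<bullet> b = 0" for X Y x
  proof (rule G2.br_eqI)
    fix w
    have "F2 [x, X, Y, w] = 0" by (rule p2) (rule that)
    then show "F2 [X, Y, x, w] = 0 \<bullet> w" using G2.swap12[of x X Y w] G2.swap23[of X x Y w] by simp
  qed
  have skew1: "G1.br X Y v \<bullet> w = - (v \<bullet> G1.br X Y w)" for X Y v w
    by (simp add: G1.br_inner inner_commute[of v] G1.swap34[of X Y v w])
  have skew2: "G2.br X Y v \<bullet> w = - (v \<bullet> G2.br X Y w)" for X Y v w
    by (simp add: G2.br_inner inner_commute[of v] G2.swap34[of X Y v w])
  have G1_T2: "F1 [G2.br X Y x, y, z, w] = 0" for X Y x y z w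
  proof (rule p1)
    fix b assume "b \<in> B1"
    then have "G2.br X Y b = 0" using B12 by (intro G2_T2)
    then show "G2.br X Y x \<bullet> b = 0" by (simp add: skew2)
  qed
  have G2_T1: "F2 [G1.br X Y x, y, z, w] = 0" for X Y x y z w
  proof (rule p2)
    fix b assume "b \<in> B2"
    then have "G1.br X Y b = 0" using B12 by (intro G1_T1) (simp add: inner_commute)
    then show "G1.br X Y x \<bullet> b = 0" by (simp add: skew1)
  qed
  have br: "G.br X Y x = G1.br X Y x + G2.br X Y x" for X Y x
    by (rule G.br_eqI) (simp add: inner_add_left G1.br_inner G2.br_inner)
  show ?thesis
  proof
    fix X Y x y z w
    have "F1 [G1.br X Y x, y, z, w] + F1 [x, G1.br X Y y, z, w] + F1 [x, y, G1.br X Y z, w]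
        + F1 [x, y, z, G1.br X Y w] = 0"
      by (rule G1.derivation_of_skew[OF B1])
        (assumption | rule p1 G1_T1 G1.br_linear | simp add: G1.br_inner)+
    moreover have "F2 [G2.br X Y x, y, z, w] + F2 [x, G2.br X Y y, z, w] + F2 [x, y, G2.br X Y z, w]
        + F2 [x, y, z, G2.br X Y w] = 0"
      by (rule G2.derivation_of_skew[OF B2])
        (assumption | rule p2 G2_T2 G2.br_linear | simp add: G2.br_inner)+
    moreover have "F1 [x, G2.br X Y y, z, w] = 0" "F1 [x, y, G2.br X Y z, w] = 0" "F1 [x, y, z, G2.br X Y w] = 0"
      using G1_T2[of X Y y x z w] G1_T2[of X Y z x y w] G1_T2[of X Y w x y z]
        G1.swap12[of _ x] G1.swap23[of x _ y] G1.swap34[of x y _ z] by simp_all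
    moreover have "F2 [x, G1.br X Y y, z, w] = 0" "F2 [x, y, G1.br X Y z, w] = 0" "F2 [x, y, z, G1.br X Y w] = 0"
      using G2_T1[of X Y y x z w] G2_T1[of X Y z x y w] G2_T1[of X Y w x y z]
        G2.swap12[of _ x] G2.swap23[of x _ y] G2.swap34[of x y _ z] by simp_all
    ultimately show "F1 [G.br X Y x, y, z, w] + F2 [G.br X Y x, y, z, w]
        + (F1 [x, G.br X Y y, z, w] + F2 [x, G.br X Y y, z, w])
        + (F1 [x, y, G.br X Y z, w] + F2 [x, y, G.br X Y z, w])
        + (F1 [x, y, z, G.br X Y w] + F2 [x, y, z, G.br X Y w]) = 0"
      by (simp add: br G1.multilinear G2.multilinear G1_T2 G2_T1)
  qed
qed

section \<open>Splitting off a maximal simple summand\<close>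

text \<open>The factor \<open>c\<close> is absorbed into the first covector. For
  \<open>c = 0\<close> this is the zero form, hence the guard on the plane.\<close>

lemma simple_form4_on_orthonormal:
  fixes e1 e2 e3 e4 :: "'a::euclidean_space"
  assumes n: "norm e1 = 1" "norm e2 = 1" "norm e3 = 1" "norm e4 = 1"
    and o: "e1 \<bullet> e2 = 0" "e1 \<bullet> e3 = 0" "e1 \<bullet> e4 = 0" "e2 \<bullet> e3 = 0" "e2 \<bullet> e4 = 0" "e3 \<bullet> e4 = 0"
  shows "\<exists>\<Omega>. simple_form 4 \<Omega> \<and> \<Omega> [e1, e2, e3, e4] = c \<and>
    (\<forall>x xs. (\<forall>e\<in>{e1, e2, e3, e4}. x \<bullet> e = 0) \<longrightarrow> \<Omega> (x # xs) = 0) \<and>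
    (\<Omega> \<noteq> (\<lambda>_. 0) \<longrightarrow> plane \<Omega> \<subseteq> span {e1, e2, e3, e4})"
proof -
  define \<alpha>s where "\<alpha>s = map blinfun_inner_left [c *\<^sub>R e1, e2, e3, e4]"
  have o': "e2 \<bullet> e1 = 0" "e3 \<bullet> e1 = 0" "e4 \<bullet> e1 = 0" "e3 \<bullet> e2 = 0" "e4 \<bullet> e2 = 0" "e4 \<bullet> e3 = 0"
    using o by (simp_all add: inner_commute)
  have n': "e1 \<bullet> e1 = 1" "e2 \<bullet> e2 = 1" "e3 \<bullet> e3 = 1" "e4 \<bullet> e4 = 1"
    using n by (simp_all add: norm_eq_1)
  show ?thesis
  proof (intro exI[of _ "wedge_list \<alpha>s"] conjI allI impI)
    show "simple_form 4 (wedge_list \<alpha>s)"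
      unfolding simple_form_def by (rule exI[of _ \<alpha>s]) (simp add: \<alpha>s_def)
    show "wedge_list \<alpha>s [e1, e2, e3, e4] = c"
      by (simp add: \<alpha>s_def wedge_Cons interior_product_def interior_product_wedge
          blinfun_inner_left.rep_eq n' o o')
    fix x and xs :: "'a list" assume "\<forall>e\<in>{e1, e2, e3, e4}. x \<bullet> e = 0"
    then have "interior_product x (wedge_list \<alpha>s) = (\<lambda>_. 0)"
      by (intro interior_product_wedge_list_eq_0) (auto simp: \<alpha>s_def blinfun_inner_left.rep_eq)
    then show "wedge_list \<alpha>s (x # xs) = 0" by (simp add: interior_product_def fun_eq_iff)
  next
    assume "wedge_list \<alpha>s \<noteq> (\<lambda>_. 0)"
    then have "plane (wedge_list \<alpha>s) = span {c *\<^sub>R e1, e2, e3, e4}"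
      by (simp add: plane_wedge_list \<alpha>s_def del: wedge_list.simps)
    also have "\<dots> \<subseteq> span {e1, e2, e3, e4}"
      by (intro span_minimal) (auto intro: span_base span_scale)
    finally show "plane (wedge_list \<alpha>s) \<subseteq> span {e1, e2, e3, e4}" .
  qed
qed

text \<open>Dimension 8 enters here: the complement of a 4-plane is again 4-dimensional, so a 4-form
  living on it is a top form and hence simple.\<close>

lemma orthonormal_complement_four:
  fixes A :: "'a::euclidean_space set"
  assumes "DIM('a) = 8" "card A = 4" and A: "pairwise orthogonal A" "\<And>a. a \<in> A \<Longrightarrow> norm a = 1"
  obtains U where "card U = 4" "pairwise orthogonal U" "\<And>u. u \<in> U \<Longrightarrow> norm u = 1"
    "\<And>a u. a \<in> A \<Longrightarrow> u \<in> U \<Longrightarrow> a \<bullet> u = 0"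
    "\<And>x. (\<And>b. b \<in> A \<union> U \<Longrightarrow> x \<bullet> b = 0) \<Longrightarrow> x = 0"
proof -
  define W where "W = {y \<in> UNIV. \<forall>x\<in>span A. orthogonal x y}"
  have "subspace W" unfolding W_def by (simp add: subspace_def orthogonal_clauses)
  have "0 \<notin> A" using A(2) by force
  then have "dim (span A) = 4"
    using pairwise_orthogonal_independent[OF A(1)] assms(2) by (simp add: dim_eq_card_independent)
  then have "dim W = 4"
    using dim_subspace_orthogonal_to_vectors[of "span A" UNIV] assms(1) by (simp add: W_def)
  with orthonormal_basis_subspace[OF \<open>subspace W\<close>]
  obtain U where U: "U \<subseteq> W" "pairwise orthogonal U" "\<And>u. u \<in> U \<Longrightarrow> norm u = 1" "card U = 4" "span U = W"
    by metis
  have "a \<bullet> u = 0" if "a \<in> A" "u \<in> U" for a u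
    using U(1) that span_base unfolding W_def orthogonal_def by blast
  moreover have "x = 0" if x: "\<And>b. b \<in> A \<union> U \<Longrightarrow> x \<bullet> b = 0" for x
  proof -
    have "orthogonal x y" if "y \<in> span A" for y
      using that by (rule orthogonal_to_span) (simp add: orthogonal_def x)
    then have "x \<in> span U" unfolding U(5) W_def by (simp add: orthogonal_commute)
    then have "orthogonal x x" by (rule orthogonal_to_span) (simp add: orthogonal_def x)
    then show ?thesis by (simp add: orthogonal_self)
  qed
  ultimately show thesis using that U by blast
qed

text \<open>\<open>F1\<close> and \<open>F2\<close> are the volume forms of the maximising 4-plane
  and of its complement, each scaled to agree with \<open>F\<close> on an orthonormal basis.\<close>

lemma three_lie_orthogonal_simple_forms:
  fixes F :: "'a::euclidean_space list \<Rightarrow> real"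
  assumes dim: "DIM('a) = 8" and F: "F \<in> forms 4"
    and lie: "metric_three_lie (\<lambda>x y z w. F [x, y, z, w])"
  shows "\<exists>F1 F2. simple_form 4 F1 \<and> simple_form 4 F2 \<and> orthogonal_forms F1 F2 \<and>
    F = (\<lambda>xs. F1 xs + F2 xs)"
proof -
  have list4: "\<exists>x y z w. xs = [x, y, z, w]" if "length xs = 4" for xs :: "'a list"
    using that by (auto simp: eval_nat_numeral length_Suc_conv)
  interpret metric_three_lie "\<lambda>x y z w. F [x, y, z, w]" by fact
  show ?thesis
  proof (cases "\<exists>x y z w. F [x, y, z, w] \<noteq> 0")
    case False
    then have "F xs = 0" for xs
      using form_eq_0[OF F, of xs] list4[of xs] by metis
    then show ?thesis
      by (intro exI[of _ "\<lambda>_. 0"]) (simp add: simple_form_zero orthogonal_forms_def fun_eq_iff)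
  next
    case True
    then obtain e1 e2 e3 e4 where m: "maximal e1 e2 e3 e4" using maximal_exists by metis
    define A where "A = {e1, e2, e3, e4}"
    have n: "norm e1 = 1" "norm e2 = 1" "norm e3 = 1" "norm e4 = 1"
      using m by (simp_all add: maximal_def)
    note o = maximal_orthogonal[OF m]
    have o': "e2 \<bullet> e1 = 0" "e3 \<bullet> e1 = 0" "e4 \<bullet> e1 = 0" "e3 \<bullet> e2 = 0" "e4 \<bullet> e2 = 0" "e4 \<bullet> e3 = 0"
      using o by (simp_all add: inner_commute)
    have "e1 \<bullet> e1 = 1" "e2 \<bullet> e2 = 1" "e3 \<bullet> e3 = 1" "e4 \<bullet> e4 = 1" using n by (simp_all add: norm_eq_1)
    then have "distinct [e1, e2, e3, e4]" using o by auto
    then have A: "finite A" "card A = 4" "pairwise orthogonal A" "\<And>a. a \<in> A \<Longrightarrow> norm a = 1"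
      using n o o' by (auto simp: A_def pairwise_def orthogonal_def)
    obtain U where U: "card U = 4" "pairwise orthogonal U" "\<And>u. u \<in> U \<Longrightarrow> norm u = 1"
      and AU: "\<And>a u. a \<in> A \<Longrightarrow> u \<in> U \<Longrightarrow> a \<bullet> u = 0"
      and full: "\<And>x. (\<And>b. b \<in> A \<union> U \<Longrightarrow> x \<bullet> b = 0) \<Longrightarrow> x = 0"
      using orthonormal_complement_four[OF dim A(2-4)] by metis
    have UA: "u \<bullet> a = 0" if "a \<in> A" "u \<in> U" for a u
      using AU[OF that] by (simp add: inner_commute)
    have finU: "finite U" using U(1) card.infinite by fastforce
    obtain f1 f2 f3 f4 where f: "U = {f1, f2, f3, f4}" "distinct [f1, f2, f3, f4]"
    proof -
      obtain fs where fs: "set fs = U" "distinct fs" using finite_distinct_list[OF finU] by blast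
      then have "length fs = 4" using U(1) distinct_card by metis
      then obtain x y z w where "fs = [x, y, z, w]" using list4 by blast
      with fs show thesis by (intro that[of x y z w]) auto
    qed
    obtain F1 where F1: "simple_form 4 F1" "F1 [e1, e2, e3, e4] = F [e1, e2, e3, e4]"
      and F1_perp: "\<And>x xs. \<forall>a\<in>A. x \<bullet> a = 0 \<Longrightarrow> F1 (x # xs) = 0"
      and F1_plane: "F1 \<noteq> (\<lambda>_. 0) \<Longrightarrow> plane F1 \<subseteq> span A"
      using simple_form4_on_orthonormal[OF n o, of "F [e1, e2, e3, e4]"] unfolding A_def by metis
    have nf: "norm f1 = 1" "norm f2 = 1" "norm f3 = 1" "norm f4 = 1" using U(3) f(1) by simp_all
    have of: "f1 \<bullet> f2 = 0" "f1 \<bullet> f3 = 0" "f1 \<bullet> f4 = 0" "f2 \<bullet> f3 = 0" "f2 \<bullet> f4 = 0" "f3 \<bullet> f4 = 0"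
      using U(2) f by (auto simp: pairwise_def orthogonal_def)
    obtain F2 where F2: "simple_form 4 F2" "F2 [f1, f2, f3, f4] = F [f1, f2, f3, f4]"
      and F2_perp: "\<And>x xs. \<forall>u\<in>U. x \<bullet> u = 0 \<Longrightarrow> F2 (x # xs) = 0"
      and F2_plane: "F2 \<noteq> (\<lambda>_. 0) \<Longrightarrow> plane F2 \<subseteq> span U"
      using simple_form4_on_orthonormal[OF nf of, of "F [f1, f2, f3, f4]"] unfolding f(1) by metis
    interpret G1: alternating4 "\<lambda>x y z w. F1 [x, y, z, w]"
      by (rule alternating4_form[OF simple_form_forms[OF F1(1)]])
    interpret D: alternating4 "\<lambda>x y z w. F [x, y, z, w] - F1 [x, y, z, w]"
      by (rule alternating4_diff) (rule alternating4_axioms G1.alternating4_axioms)+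
    interpret H: alternating4 "\<lambda>x y z w. F [x, y, z, w] - F1 [x, y, z, w] - F2 [x, y, z, w]"
      by (rule alternating4_diff[OF D.alternating4_axioms alternating4_form[OF simple_form_forms[OF F2(1)]]])
    have F1_4: "F1 [x, y, z, w] = 0" if "\<And>a. a \<in> A \<Longrightarrow> w \<bullet> a = 0" for x y z w
      using F1_perp[of w "[x, y, z]"] that
        G1.swap12[of w x y z] G1.swap23[of x w y z] G1.swap34[of x y w z] by simp
    have van: "x \<in> A \<Longrightarrow> y \<in> A \<Longrightarrow> z \<in> A \<Longrightarrow> (\<And>b. b \<in> A \<Longrightarrow> w \<bullet> b = 0) \<Longrightarrow> F [x, y, z, w] = 0"
      "x \<in> A \<Longrightarrow> y \<in> A \<Longrightarrow> (\<And>b. b \<in> A \<Longrightarrow> z \<bullet> b = 0) \<Longrightarrow> F [x, y, z, w] = 0"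
      "x \<in> A \<Longrightarrow> (\<And>b. b \<in> A \<Longrightarrow> y \<bullet> b = 0) \<Longrightarrow> (\<And>b. b \<in> A \<Longrightarrow> z \<bullet> b = 0) \<Longrightarrow>
      (\<And>b. b \<in> A \<Longrightarrow> w \<bullet> b = 0) \<Longrightarrow> F [x, y, z, w] = 0" for x y z w
      unfolding A_def by (rule maximal_vanishing[OF m]; assumption)+
    \<comment> \<open>Mixed components vanish for both \<open>F\<close> and \<open>F1\<close>; on
      \<open>A\<close> itself a single value remains, where they agree.\<close>
    have DA: "F [x, y, z, w] - F1 [x, y, z, w] = 0" if "x \<in> A" for x y z w
    proof (rule D.eq_0_on_subspace[OF A(1,3,4) _ _ _ _ that])
      show "F [x, y, z, w] - F1 [x, y, z, w] = 0" if "x \<in> A" "y \<in> A" "z \<in> A" "w \<in> A" for x y z w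
        by (rule D.eq_0_on_four[of e1 e2 e3 e4]) (use that F1(2) in \<open>simp_all add: A_def\<close>)
    qed (simp_all add: van F1_4)
    have "F [x, y, z, w] - F1 [x, y, z, w] - F2 [x, y, z, w] = 0" for x y z w
    proof (rule H.eq_0I[OF finU U(2,3)])
      fix x y z w assume x: "\<And>b. b \<in> U \<Longrightarrow> x \<bullet> b = 0"
      \<comment> \<open>Only members of \<open>A\<close> have nonzero coefficients, and there the
        difference vanishes by \<open>DA\<close>.\<close>
      have "F [x, y, z, w] - F1 [x, y, z, w] = (\<Sum>b\<in>A \<union> U. (x \<bullet> b) * (F [b, y, z, w] - F1 [b, y, z, w]))"
      proof (rule orthonormal_linear_expansion[OF D.linear1])
        show "finite (A \<union> U)" using A(1) finU by simp
        show "pairwise orthogonal (A \<union> U)"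
          using A(3) U(2) by (auto simp: pairwise_def orthogonal_def AU UA)
        show "norm b = 1" if "b \<in> A \<union> U" for b using that A(4) U(3) by blast
        show "F [v, y, z, w] - F1 [v, y, z, w] = 0" if "\<And>b. b \<in> A \<union> U \<Longrightarrow> v \<bullet> b = 0" for v
        proof -
          have "v = 0" by (rule full) (rule that)
          then show ?thesis by (simp add: D.multilinear)
        qed
      qed
      also have "\<dots> = 0" using DA x by (intro sum.neutral) auto
      finally show "F [x, y, z, w] - F1 [x, y, z, w] - F2 [x, y, z, w] = 0" using F2_perp x by simp
    next
      fix x y z w assume "x \<in> U" "y \<in> U" "z \<in> U" "w \<in> U"
      moreover have "F1 [f1, f2, f3, f4] = 0"
        by (rule F1_perp) (simp add: UA f(1))
      ultimately show "F [x, y, z, w] - F1 [x, y, z, w] - F2 [x, y, z, w] = 0"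
        by - (rule H.eq_0_on_four[of f1 f2 f3 f4], simp_all add: F2(2) f(1))
    qed
    then have eq4: "F [x, y, z, w] = F1 [x, y, z, w] + F2 [x, y, z, w]" for x y z w
      by (simp add: algebra_simps)
    have eq: "F xs = F1 xs + F2 xs" for xs
    proof (cases "length xs = 4")
      case True
      then show ?thesis using list4[of xs] eq4 by blast
    next
      case False
      then show ?thesis
        by (simp add: form_eq_0[OF F] form_eq_0[OF simple_form_forms[OF F1(1)]]
            form_eq_0[OF simple_form_forms[OF F2(1)]])
    qed
    have "x1 \<bullet> x2 = 0"
      if "F1 \<noteq> (\<lambda>_. 0)" "F2 \<noteq> (\<lambda>_. 0)" "x1 \<in> plane F1" "x2 \<in> plane F2" for x1 x2
    proof -
      have s: "x1 \<in> span A" "x2 \<in> span U" using that F1_plane F2_plane by blast+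
      have "orthogonal u x1" if "u \<in> U" for u
        by (rule orthogonal_to_span[OF s(1)]) (simp add: orthogonal_def UA that)
      then have "orthogonal x1 x2"
        by (intro orthogonal_to_span[OF s(2)]) (simp add: orthogonal_commute)
      then show ?thesis by (simp add: orthogonal_def)
    qed
    then have "orthogonal_forms F1 F2" unfolding orthogonal_forms_def by blast
    with F1(1) F2(1) eq show ?thesis by blast
  qed
qed

theorem mainTheorem4:
  fixes F :: "'a::euclidean_space list \<Rightarrow> real"
  assumes "DIM('a) = 8"
    and "F \<in> forms 4"
  shows "(\<forall>\<Xi> \<in> forms 2. action (contract \<Xi> F) F = (\<lambda>_. 0)) \<longleftrightarrow>
    (\<exists>F1 F2. simple_form 4 F1 \<and> simple_form 4 F2 \<and> orthogonal_forms F1 F2 \<and>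
       F = (\<lambda>xs. F1 xs + F2 xs))"
  unfolding action_contract_eq_0_iff[OF assms(2)]
  using three_lie_orthogonal_simple_forms[OF assms] orthogonal_simple_forms_three_lie by blast

end
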